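(* Let $n\ge 1$ be an integer and let $L:\mathcal{P}_n\to\mathbb{C}[z]$ be a linear operator. Then the following are equivalent. (A) For every $P\in\mathcal{P}_n$ such that both $P$ and $L[P]$ are non-constant, $\operatorname{diam} Z(L[P])\le \operatorname{diam} Z(P)$. (B) $L$ has (at least) one of the following forms: 1) $L=z\,l_1+l_2$, i.e. $L[P](z)=l_1(P)\,z+l_2(P)$ for all $P\in\mathcal{P}_n$, where $l_1,l_2:\mathcal{P}_n\to\mathbb{C}$ are linear functionals; 2) $L=(z-c)^m\,l_3$, i.e. $L[P](z)=l_3(P)\,(z-c)^m$ for all $P\in\mathcal{P}_n$, where $m\ge 2$ is an integer, $c\in\mathbb{C}$, and $l_3:\mathcal{P}_n\to\mathbb{C}$ is a nonzero linear functional; 3) there exist $c\in\mathbb{C}\setminus\{0\}$, an integer $k$ with $0\le k\le n-2$, and a polynomial $\mathcal{L}\in\mathcal{P}_1$ whose (constant) derivative satisfies $|\mathcal{L}'|\ge d_{n,k}$, such that $L[P]=c\,(P\circ\mathcal{L})^{(k)}$ for all $P\in\mathcal{P}_n$. Moreover, under the convention $\operatorname{diam}\emptyset=0$, property (A) may be replaced by the property that $\operatorname{diam} Z(L[P])\le\operatorname{diam} Z(P)$ for every $P\in\mathcal{P}_n$ with $L[P]\ne 0$. The same statements hold for $n=\infty$, i.e. for linear operators $L:\mathbb{C}[z]\to\mathbb{C}[z]$ (with $\mathcal{P}_n$ replaced by $\mathbb{C}[z]$ throughout), where in form 3) $k\ge 0$ is an arbitrary integer and the condition on $\mathcal{L}\in\mathcal{P}_1$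 is $|\mathcal{L}'|\ge 1$.
   Context: $\mathbb{C}[z]$ is the space of complex polynomials in one variable, and for an integer $m\ge 0$, $\mathcal{P}_m=\{P\in\mathbb{C}[z]:\deg P\le m\}$ (including the zero polynomial). For $Q\in\mathbb{C}[z]$, $Z(Q)\subset\mathbb{C}$ denotes the set of zeros of $Q$, and $\operatorname{diam}$ denotes the Euclidean diameter of a subset of $\mathbb{C}$, with $\operatorname{diam}\emptyset=0$. $P^{(k)}$ denotes the $k$-th derivative of $P$ (with $P^{(0)}=P$), and $(P\circ\mathcal{L})(z)=P(\mathcal{L}(z))$. For integers $0\le k\le n-2$, $d_{n,k}\in(0,1]$ denotes the smallest number such that $\operatorname{diam} Z(P^{(k)})\le d_{n,k}\operatorname{diam} Z(P)$ for every $P\in\mathcal{P}_n\setminus\mathcal{P}_k$ (i.e. every complex polynomial $P$ with $k<\deg P\le n$). *)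

theory Defs
  imports "HOL-Analysis.Analysis" "HOL-Computational_Algebra.Polynomial"
begin

definition polys_upto :: "nat \<Rightarrow> complex poly set" where
  "polys_upto m = {P. degree P \<le> m}"

definition zeros :: "complex poly \<Rightarrow> complex set" where
  "zeros Q = {z. poly Q z = 0}"

text \<open>
  For \<open>k + 2 \<le> n\<close> the minimum exists and lies in \<open>(0, 1]\<close>: the admissible \<open>d\<close> form
  a closed set, \<open>1\<close> is admissible by the Gauss-Lucas theorem, and no \<open>d \<le> 0\<close> is
  admissible because some \<open>P\<close> of degree \<open>k + 2\<close> has a \<open>k\<close>-th derivative with two
  distinct zeros.  The constant is not used for other values of \<open>n\<close> and \<open>k\<close>.
\<close>

definition diam_const :: "nat \<Rightarrow> nat \<Rightarrow> real" where
  "diam_const n k =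
     (LEAST d. \<forall>P \<in> polys_upto n - polys_upto k.
        diameter (zeros ((pderiv ^^ k) P)) \<le> d * diameter (zeros P))"

text \<open>
  Linearity of a map defined on a subspace \<open>V\<close>; the values outside \<open>V\<close> play no role.
\<close>

definition linear_on ::
  "'a::ab_group_add set \<Rightarrow> ('c \<Rightarrow> 'a \<Rightarrow> 'a) \<Rightarrow> ('c \<Rightarrow> 'b::ab_group_add \<Rightarrow> 'b) \<Rightarrow> ('a \<Rightarrow> 'b) \<Rightarrow> bool"
  where
  "linear_on V s t f \<longleftrightarrow>
     (\<forall>x\<in>V. \<forall>y\<in>V. f (x + y) = f x + f y) \<and> (\<forall>c. \<forall>x\<in>V. f (s c x) = t c (f x))"

abbreviation linear_operator_on ::
  "complex poly set \<Rightarrow> (complex poly \<Rightarrow> complex poly) \<Rightarrow> bool" where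
  "linear_operator_on V \<equiv> linear_on V smult smult"

abbreviation linear_functional_on ::
  "complex poly set \<Rightarrow> (complex poly \<Rightarrow> complex) \<Rightarrow> bool" where
  "linear_functional_on V \<equiv> linear_on V smult (*)"

lemma linear_on_UNIV_iff:
  assumes "vector_space s" "vector_space t"
  shows "linear_on UNIV s t f \<longleftrightarrow> Vector_Spaces.linear s t f"
  using assms
  by (auto simp: linear_on_def Vector_Spaces.linear_def module_hom_def module_hom_axioms_def
      module_iff_vector_space)

text \<open>
  If \<open>L\<close> is linear on the subspace \<open>V\<close>, then \<open>L P \<noteq> 0\<close> implies \<open>P \<noteq> 0\<close>, so in the next
  two definitions all zero sets are finite; \<^const>\<open>diameter\<close> of the empty set is \<open>0\<close>.
\<close>

definition diam_nonincreasing ::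
  "complex poly set \<Rightarrow> (complex poly \<Rightarrow> complex poly) \<Rightarrow> bool" where
  "diam_nonincreasing V L \<longleftrightarrow>
     (\<forall>P\<in>V. degree P > 0 \<and> degree (L P) > 0 \<longrightarrow>
        diameter (zeros (L P)) \<le> diameter (zeros P))"

definition diam_nonincreasing_nonzero ::
  "complex poly set \<Rightarrow> (complex poly \<Rightarrow> complex poly) \<Rightarrow> bool" where
  "diam_nonincreasing_nonzero V L \<longleftrightarrow>
     (\<forall>P\<in>V. L P \<noteq> 0 \<longrightarrow> diameter (zeros (L P)) \<le> diameter (zeros P))"

definition affine_form ::
  "complex poly set \<Rightarrow> (complex poly \<Rightarrow> complex poly) \<Rightarrow> bool" where
  "affine_form V L \<longleftrightarrow>
     (\<exists>l1 l2. linear_functional_on V l1 \<and> linear_functional_on V l2 \<and>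
        (\<forall>P\<in>V. L P = [:l2 P, l1 P:]))"

definition power_form ::
  "complex poly set \<Rightarrow> (complex poly \<Rightarrow> complex poly) \<Rightarrow> bool" where
  "power_form V L \<longleftrightarrow>
     (\<exists>l3 m c. 2 \<le> m \<and> linear_functional_on V l3 \<and> (\<exists>P\<in>V. l3 P \<noteq> 0) \<and>
        (\<forall>P\<in>V. L P = smult (l3 P) ([:-c, 1:] ^ m)))"

definition derivative_form ::
  "complex poly set \<Rightarrow> nat \<Rightarrow> real \<Rightarrow> (complex poly \<Rightarrow> complex poly) \<Rightarrow> bool" where
  "derivative_form V k d L \<longleftrightarrow>
     (\<exists>c l. c \<noteq> 0 \<and> l \<in> polys_upto 1 \<and> (\<forall>z. cmod (poly (pderiv l) z) \<ge> d) \<and>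
        (\<forall>P\<in>V. L P = smult c ((pderiv ^^ k) (pcompose P l))))"

end

theory Submission
  imports Defs "HOL-Computational_Algebra.Fundamental_Theorem_Algebra"
begin

text \<open>
  Suppose that \<open>L\<close> does not increase diameters.  The zero set of \<open>(z - w)\<^sup>j\<close> has diameter
  \<open>0\<close>, so \<open>L[(z - w)\<^sup>j]\<close> is a constant or a multiple of a power of a linear polynomial.
  Write \<open>L[(z - w)\<^sup>n] = \<Sum>\<^sub>i q\<^sub>i(w) z\<^sup>i\<close> with polynomials \<open>q\<^sub>i\<close>, let \<open>m\<close> be maximal with
  \<open>q\<^sub>m \<noteq> 0\<close>, and suppose \<open>m \<ge> 2\<close>.  Comparing coefficients of an \<open>m\<close>-th power gives
  \<open>2 m q\<^sub>m q\<^sub>m\<^sub>-\<^sub>2 = (m - 1) q\<^sub>m\<^sub>-\<^sub>1\<^sup>2\<close>.  Differentiating in \<open>w\<close> replaces \<open>(z - w)\<^sup>n\<close> by a multiple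
  of \<open>(z - w)\<^sup>n\<^sup>-\<^sup>1\<close>, so the derivatives of the \<open>q\<^sub>i\<close> satisfy the same relation unless \<open>q\<^sub>m\<close>
  is constant.  Both relations together force the Wronskian of \<open>q\<^sub>m\<close> and \<open>q\<^sub>m\<^sub>-\<^sub>1\<close> to vanish,
  which means that the zero of \<open>L[(z - w)\<^sup>n]\<close> does not depend on \<open>w\<close>: this is form 2.  If
  \<open>q\<^sub>m\<close> is constant, the zero is a polynomial in \<open>w\<close> of some degree \<open>r\<close>, and testing with
  \<open>z\<^sup>n + t\<^sup>r\<^sup>m z\<^sup>n\<^sup>-\<^sup>r\<^sup>m\<close> for large \<open>t\<close> shows \<open>r \<le> 1\<close>.  The case \<open>r = 1\<close> is form 3, with
  \<open>k = n - m\<close>, because the powers \<open>(z - w)\<^sup>n\<close> span the polynomials of degree at most \<open>n\<close>.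
\<close>

section \<open>Diameters of zero sets and the Gauss-Lucas theorem\<close>

lemma zeros_empty_if_degree_0:
  assumes "degree Q = 0" "Q \<noteq> 0"
  shows "zeros Q = {}"
  using assms by (auto simp: zeros_def elim!: degree_eq_zeroE)

lemma bounded_zeros: "Q \<noteq> 0 \<Longrightarrow> bounded (zeros Q)"
  by (simp add: zeros_def poly_roots_finite finite_imp_bounded)

lemma diameter_zeros_nonneg: "Q \<noteq> 0 \<Longrightarrow> 0 \<le> diameter (zeros Q)"
  by (simp add: bounded_zeros diameter_ge_0)

lemma norm_diff_le_diameter_zeros:
  "Q \<noteq> 0 \<Longrightarrow> poly Q x = 0 \<Longrightarrow> poly Q y = 0 \<Longrightarrow> cmod (x - y) \<le> diameter (zeros Q)"
  using diameter_bounded_bound[OF bounded_zeros, of Q x y] by (simp add: zeros_def dist_norm)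

lemma diameter_zeros_linear_power:
  assumes "j > 0"
  shows "diameter (zeros ([:- w, 1:] ^ j)) = 0"
proof -
  have "zeros ([:- w, 1:] ^ j) = {w}"
    using assms by (auto simp: zeros_def)
  then show ?thesis by simp
qed

lemma diameter_zeros_degree_1:
  assumes "degree Q \<le> 1" "Q \<noteq> 0"
  shows "diameter (zeros Q) = 0"
proof -
  define a b where "a = coeff Q 0" and "b = coeff Q 1"
  have Q: "Q = [:a, b:]"
    using assms(1) by (intro poly_eqI) (auto simp: a_def b_def coeff_pCons coeff_eq_0 split: nat.splits)
  have "x = - a / b" if "poly Q x = 0" for x
  proof -
    have eq: "a + x * b = 0" using that by (simp add: Q)
    then have "b \<noteq> 0" using assms(2) by (auto simp: Q)
    then show ?thesis using eq by (simp add: field_simps add_eq_0_iff)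
  qed
  then have "zeros Q \<subseteq> {- a / b}" by (auto simp: zeros_def)
  then show ?thesis
    by (metis diameter_empty diameter_singleton subset_singletonD)
qed

text \<open>A ball of radius \<open>diameter S\<close> about a point of \<open>S\<close> contains
  \<open>S\<close>, hence its hull. By symmetry the ball of the same radius about any point of the
  hull contains \<open>S\<close>, hence again the hull.\<close>

lemma diameter_convex_hull_le:
  fixes S :: "'a::euclidean_space set"
  assumes "bounded S" "T \<subseteq> convex hull S"
  shows "diameter T \<le> diameter S"
proof (rule diameter_le)
  show "T \<noteq> {} \<or> 0 \<le> diameter S"
    by (simp add: assms(1) diameter_ge_0)
  have one: "convex hull S \<subseteq> cball x (diameter S)" if "x \<in> S" for x
    by (rule hull_minimal) (use that assms(1) diameter_bounded_bound in auto)
  have two: "convex hull S \<subseteq> cball x (diameter S)" if "x \<in> convex hull S" for x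
    by (rule hull_minimal) (use one that in \<open>force simp: dist_commute\<close>, rule convex_cball)
  show "norm (x - y) \<le> diameter S" if "x \<in> T" "y \<in> T" for x y
    using two[of x] assms(2) that by (auto simp: dist_norm subset_iff)
qed

text \<open>
  The logarithmic derivative at a point strictly separated from all zeros lies in an open
  half plane, because each summand \<open>1 / (z - x)\<close> does.
\<close>

lemma logarithmic_derivative_half_plane:
  assumes "P \<noteq> 0" "\<And>x. poly P x = 0 \<Longrightarrow> Re (a * cnj (z - x)) < 0"
  shows "(if degree P = 0 then pderiv P = 0 else Re (a * (poly (pderiv P) z / poly P z)) < 0)"
  using assms
proof (induction "degree P" arbitrary: P)
  case 0
  then show ?case by (auto elim!: degree_eq_zeroE)
next
  case (Suc d)
  then obtain x where x: "poly P x = 0"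
    using fundamental_theorem_of_algebra[of P] by (auto simp: constant_degree)
  then obtain R where R: "P = [:- x, 1:] * R"
    by (auto simp: poly_eq_0_iff_dvd)
  have R0: "R \<noteq> 0" using Suc R by auto
  then have "degree R = d" using Suc.hyps(2) degree_mult_eq[of "[:- x, 1:]" R] R by simp
  then have IH: "if degree R = 0 then pderiv R = 0 else Re (a * (poly (pderiv R) z / poly R z)) < 0"
    using Suc.hyps(1)[of R] Suc.prems R0 by (auto simp: R)
  have zx: "z \<noteq> x" using Suc.prems(2)[OF x] by auto
  have Rz: "poly R z \<noteq> 0" using Suc.prems(2)[of z] by (auto simp: R)
  have "poly (pderiv P) z / poly P z = 1 / (z - x) + poly (pderiv R) z / poly R z"
    unfolding R pderiv_mult using zx Rz
    by (simp add: pderiv_pCons divide_simps del: mult_pCons_left)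
  then have "Re (a * (poly (pderiv P) z / poly P z)) =
      Re (a * (1 / (z - x))) + Re (a * (poly (pderiv R) z / poly R z))"
    by (simp add: distrib_left)
  moreover have "Re (a * (1 / (z - x))) < 0"
  proof -
    have "a * (1 / (z - x)) = a * cnj (z - x) / of_real ((cmod (z - x))\<^sup>2)"
      using zx by (simp only: complex_norm_square) (simp del: complex_cnj_diff)
    then have "Re (a * (1 / (z - x))) = Re (a * cnj (z - x)) / (cmod (z - x))\<^sup>2"
      by (simp only: Re_divide_of_real)
    then show ?thesis
      using Suc.prems(2)[OF x] zx by (simp add: divide_neg_pos del: complex_cnj_diff)
  qed
  moreover have "Re (a * (poly (pderiv R) z / poly R z)) \<le> 0"
    using IH by (auto split: if_splits)
  ultimately show ?case using Suc.hyps(2) by simp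
qed

text \<open>A line strictly separates a point outside the hull from all zeros, so the logarithmic
  derivative at that point lies in an open half plane and is not 0.\<close>

lemma Gauss_Lucas:
  assumes "degree P > 0"
  shows "zeros (pderiv P) \<subseteq> convex hull (zeros P)"
proof
  fix z assume z: "z \<in> zeros (pderiv P)"
  show "z \<in> convex hull (zeros P)"
  proof (rule ccontr)
    assume nz: "z \<notin> convex hull (zeros P)"
    have P0: "P \<noteq> 0" using assms by auto
    have "closed (convex hull (zeros P))"
      by (intro compact_imp_closed finite_imp_compact_convex_hull)
        (use P0 in \<open>simp add: zeros_def poly_roots_finite\<close>)
    then obtain a b where ab: "inner a z < b" "\<forall>x\<in>convex hull (zeros P). inner a x > b"
      using separating_hyperplane_closed_point[OF convex_convex_hull _ nz] by blast
    have "Re (a * cnj (z - x)) < 0" if "poly P x = 0" for x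
    proof -
      have "inner a x > b" using ab(2) that hull_inc[of x "zeros P"] by (auto simp: zeros_def)
      then show ?thesis using ab(1) by (simp add: inner_complex_def algebra_simps)
    qed
    from logarithmic_derivative_half_plane[OF P0 this] assms z show False
      by (simp add: zeros_def)
  qed
qed

section \<open>Higher derivatives and the constant \<open>diam_const\<close>\<close>

lemma degree_higher_pderiv:
  fixes P :: "'a::{comm_semiring_1,semiring_no_zero_divisors,semiring_char_0} poly"
  shows "degree ((pderiv ^^ k) P) = degree P - k"
  by (induction k) (auto simp: degree_pderiv)

lemma diameter_zeros_higher_pderiv_le:
  assumes "k < degree P"
  shows "diameter (zeros ((pderiv ^^ k) P)) \<le> diameter (zeros P)"
  using assms
proof (induction k)
  case (Suc k)
  let ?R = "(pderiv ^^ k) P"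
  have d: "degree ?R > 0" using Suc.prems by (simp add: degree_higher_pderiv)
  then have "diameter (zeros (pderiv ?R)) \<le> diameter (zeros ?R)"
    by (intro diameter_convex_hull_le Gauss_Lucas bounded_zeros) auto
  then show ?case using Suc by simp
qed simp

text \<open>\<open>LEAST\<close> on the reals is informative only if the minimum is attained. The
  admissible constants are bounded below by 0, and non-strict inequalities pass to the infimum,
  which is therefore the least of them.\<close>

lemma diam_const_properties:
  assumes "k + 2 \<le> n"
  shows diam_const_admissible:
      "P \<in> polys_upto n - polys_upto k \<Longrightarrow>
        diameter (zeros ((pderiv ^^ k) P)) \<le> diam_const n k * diameter (zeros P)"
    and diam_const_le:
      "(\<And>P. P \<in> polys_upto n - polys_upto k \<Longrightarrow>
        diameter (zeros ((pderiv ^^ k) P)) \<le> d * diameter (zeros P)) \<Longrightarrow> diam_const n k \<le> d"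
proof -
  define S where "S = {d. \<forall>P\<in>polys_upto n - polys_upto k.
    diameter (zeros ((pderiv ^^ k) P)) \<le> d * diameter (zeros P)}"
  have nz: "P \<noteq> 0" "(pderiv ^^ k) P \<noteq> 0" if "P \<in> polys_upto n - polys_upto k" for P
  proof -
    have "degree ((pderiv ^^ k) P) > 0"
      using that by (auto simp: degree_higher_pderiv polys_upto_def)
    then show "(pderiv ^^ k) P \<noteq> 0" "P \<noteq> 0" by auto
  qed
  have one: "1 \<in> S"
    using diameter_zeros_higher_pderiv_le by (auto simp: S_def polys_upto_def)
  have lower: "0 \<le> d" if "d \<in> S" for d
  proof -
    \<comment> \<open>Of degree \<open>k + 2\<close> with zeros 0 and 1: its zero set has positive
      diameter, so a negative \<open>d\<close> would bound a diameter by a negative number.\<close>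
    define P :: "complex poly" where "P = monom 1 (Suc k) * [:- 1, 1:]"
    have "degree P = k + 2"
      unfolding P_def by (subst degree_mult_eq) (auto simp: degree_monom_eq)
    then have mem: "P \<in> polys_upto n - polys_upto k"
      using assms by (auto simp: polys_upto_def)
    have "poly P 0 = 0" "poly P 1 = 0" by (simp_all add: P_def poly_monom)
    from norm_diff_le_diameter_zeros[OF nz(1)[OF mem] this]
    have "diameter (zeros P) \<ge> 1" by simp
    moreover have "0 \<le> d * diameter (zeros P)"
      using mem that diameter_zeros_nonneg[OF nz(2)[OF mem]] unfolding S_def by (blast intro: order_trans)
    ultimately show ?thesis by (simp add: zero_le_mult_iff)
  qed
  then have bdd: "bdd_below S" by (auto simp: bdd_below_def)
  have Inf_admissible: "diameter (zeros ((pderiv ^^ k) P)) \<le> Inf S * diameter (zeros P)"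
    if P: "P \<in> polys_upto n - polys_upto k" for P
  \<comment> \<open>The infimum is compared with a quotient of diameters; when the denominator
    vanishes, admissibility of 1 settles the claim.\<close>
  proof (cases "diameter (zeros P) = 0")
    case True
    moreover have "diameter (zeros ((pderiv ^^ k) P)) \<le> 1 * diameter (zeros P)"
      using one P unfolding S_def by blast
    ultimately show ?thesis by simp
  next
    case False
    then have pos: "diameter (zeros P) > 0"
      using diameter_zeros_nonneg[OF nz(1)[OF P]] by simp
    have "diameter (zeros ((pderiv ^^ k) P)) / diameter (zeros P) \<le> Inf S"
    proof (rule cInf_greatest)
      show "S \<noteq> {}" using one by blast
      show "diameter (zeros ((pderiv ^^ k) P)) / diameter (zeros P) \<le> d" if "d \<in> S" for d
        using that P pos by (auto simp: S_def pos_divide_le_eq)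
    qed
    then show ?thesis using pos by (simp add: field_simps)
  qed
  then have "Inf S \<in> S" unfolding S_def mem_Collect_eq by blast
  moreover have "diam_const n k = (LEAST d. d \<in> S)" by (simp add: diam_const_def S_def)
  ultimately have eq: "diam_const n k = Inf S"
    using bdd by (simp add: Least_equality cInf_lower)
  show "diameter (zeros ((pderiv ^^ k) P)) \<le> diam_const n k * diameter (zeros P)"
    if "P \<in> polys_upto n - polys_upto k" for P
    using Inf_admissible[OF that] by (simp only: eq)
  show "diam_const n k \<le> d"
    if "\<And>P. P \<in> polys_upto n - polys_upto k \<Longrightarrow>
        diameter (zeros ((pderiv ^^ k) P)) \<le> d * diameter (zeros P)" for d
  proof -
    have "d \<in> S" using that by (auto simp: S_def)
    then show ?thesis using bdd by (simp add: eq cInf_lower)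
  qed
qed

text \<open>The map from \<open>z\<close> to \<open>a z + b\<close> carries the zeros of the
  composition bijectively onto those of \<open>Q\<close> and multiplies distances by
  \<open>cmod a\<close>.\<close>

lemma diameter_zeros_pcompose:
  assumes "a \<noteq> 0" "Q \<noteq> 0"
  shows "diameter (zeros Q) = cmod a * diameter (zeros (pcompose Q [:b, a:]))"
proof -
  let ?R = "pcompose Q [:b, a:]"
  have R0: "?R \<noteq> 0" using assms by (simp add: pcompose_eq_0_iff)
  have "diameter (zeros Q) \<le> cmod a * diameter (zeros ?R)"
  proof (rule diameter_le)
    show "zeros Q \<noteq> {} \<or> 0 \<le> cmod a * diameter (zeros ?R)"
      using diameter_zeros_nonneg[OF R0] by simp
    fix x y assume xy: "x \<in> zeros Q" "y \<in> zeros Q"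
    have "cmod ((x - b) / a - (y - b) / a) \<le> diameter (zeros ?R)"
      using xy assms by (intro norm_diff_le_diameter_zeros R0) (auto simp: zeros_def poly_pcompose)
    moreover have "x - y = a * ((x - b) / a - (y - b) / a)"
      using assms by (simp add: field_simps)
    ultimately show "norm (x - y) \<le> cmod a * diameter (zeros ?R)"
      by (metis mult_left_mono norm_ge_zero norm_mult)
  qed
  moreover have "diameter (zeros ?R) \<le> diameter (zeros Q) / cmod a"
  proof (rule diameter_le)
    show "zeros ?R \<noteq> {} \<or> 0 \<le> diameter (zeros Q) / cmod a"
      using diameter_zeros_nonneg[OF assms(2)] by simp
    fix x y assume xy: "x \<in> zeros ?R" "y \<in> zeros ?R"
    have "cmod ((b + a * x) - (b + a * y)) \<le> diameter (zeros Q)"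
      using xy by (intro norm_diff_le_diameter_zeros assms)
        (auto simp: zeros_def poly_pcompose mult.commute)
    moreover have "(b + a * x) - (b + a * y) = a * (x - y)" by (simp add: algebra_simps)
    ultimately have "cmod a * cmod (x - y) \<le> diameter (zeros Q)"
      by (simp only: norm_mult)
    then show "norm (x - y) \<le> diameter (zeros Q) / cmod a"
      using assms by (simp add: pos_le_divide_eq mult.commute)
  qed
  ultimately show ?thesis using assms(1) by (simp add: field_simps)
qed

text \<open>The chain rule contributes one factor \<open>a\<close> per derivative. Form 3 can thus
  be treated with the substitution performed after the differentiation.\<close>

lemma higher_pderiv_pcompose_linear:
  fixes P :: "complex poly"
  shows "(pderiv ^^ k) (pcompose P [:b, a:]) = smult (a ^ k) (pcompose ((pderiv ^^ k) P) [:b, a:])"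
  by (induction k) (simp_all add: pderiv_smult pderiv_pcompose pderiv_pCons mult.commute)

lemma zeros_smult: "c \<noteq> 0 \<Longrightarrow> zeros (smult c Q) = zeros Q"
  by (simp add: zeros_def)

section \<open>Images of powers of linear polynomials\<close>

lemma linear_operator_on_0: "linear_operator_on V L \<Longrightarrow> 0 \<in> V \<Longrightarrow> L 0 = 0"
  unfolding linear_on_def by (metis smult_0_left)

lemma linear_operator_on_sum:
  assumes "linear_operator_on (polys_upto n) L" "\<And>j. j \<in> A \<Longrightarrow> g j \<in> polys_upto n"
  shows "L (\<Sum>j\<in>A. smult (f j) (g j)) = (\<Sum>j\<in>A. smult (f j) (L (g j)))"
proof -
  have zero: "L 0 = 0"
    by (rule linear_operator_on_0[OF assms(1)]) (simp add: polys_upto_def)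
  show ?thesis
    using assms(2)
  proof (induction A rule: infinite_finite_induct)
    case (insert x F)
    have "smult (f x) (g x) \<in> polys_upto n" "(\<Sum>j\<in>F. smult (f j) (g j)) \<in> polys_upto n"
      using insert.prems insert.hyps(1)
      by (auto simp: polys_upto_def intro!: degree_sum_le order_trans[OF degree_smult_le])
    then have "L (smult (f x) (g x) + (\<Sum>j\<in>F. smult (f j) (g j))) =
        L (smult (f x) (g x)) + L (\<Sum>j\<in>F. smult (f j) (g j))"
      using assms(1) unfolding linear_on_def by blast
    moreover have "L (smult (f x) (g x)) = smult (f x) (L (g x))"
      using assms(1) insert.prems unfolding linear_on_def by blast
    ultimately show ?case using insert by simp
  qed (simp_all add: zero)
qed

lemma linear_operator_on_expansion:
  assumes "linear_operator_on (polys_upto n) L" "P \<in> polys_upto n"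
  shows "L P = (\<Sum>j\<le>n. smult (coeff P j) (L (monom 1 j)))"
proof -
  have "P = (\<Sum>j\<le>n. smult (coeff P j) (monom 1 j))"
    using assms(2) poly_as_sum_of_monoms'[of P n] by (simp add: polys_upto_def smult_monom)
  then show ?thesis
    using linear_operator_on_sum[OF assms(1), of "{..n}" "monom 1" "coeff P"]
    by (auto simp: polys_upto_def degree_monom_eq)
qed

section \<open>Coefficients of \<open>L[(z - w)^n]\<close> as polynomials in
  \<open>w\<close>\<close>

lemma linear_power_in_polys_upto: "j \<le> n \<Longrightarrow> [:- w, 1:] ^ j \<in> polys_upto n"
  by (simp add: polys_upto_def degree_linear_power)

text \<open>The \<open>q_i\<close> of the outline, written out by the binomial theorem: for linear
  \<open>L\<close> the value at \<open>w\<close> is the coefficient of \<open>z^i\<close> in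
  \<open>L[(z - w)^n]\<close>. The image of \<open>z^j\<close> enters only at
  \<open>w^(n - j)\<close>.\<close>

definition power_symbol :: "(complex poly \<Rightarrow> complex poly) \<Rightarrow> nat \<Rightarrow> nat \<Rightarrow> complex poly" where
  "power_symbol L n i =
     (\<Sum>j\<le>n. monom (of_nat (n choose j) * (- 1) ^ (n - j) * coeff (L (monom 1 j)) i) (n - j))"

lemma poly_power_symbol:
  assumes "linear_operator_on (polys_upto n) L"
  shows "poly (power_symbol L n i) w = coeff (L ([:- w, 1:] ^ n)) i"
proof -
  have "L ([:- w, 1:] ^ n) =
      (\<Sum>j\<le>n. smult (of_nat (n choose j) * (- w) ^ (n - j)) (L (monom 1 j)))"
    using linear_operator_on_expansion[OF assms linear_power_in_polys_upto[OF order_refl]]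
    by (simp add: coeff_linear_poly_power)
  then show ?thesis
    by (simp add: power_symbol_def poly_sum poly_monom coeff_sum power_minus[of w] mult_ac)
qed

lemma coeff_power_symbol:
  assumes "j \<le> n"
  shows "coeff (power_symbol L n i) (n - j) =
    of_nat (n choose j) * (- 1) ^ (n - j) * coeff (L (monom 1 j)) i"
proof -
  have "coeff (power_symbol L n i) (n - j) =
      (\<Sum>l\<le>n. if l = j then of_nat (n choose l) * (- 1) ^ (n - l) * coeff (L (monom 1 l)) i else 0)"
    unfolding power_symbol_def coeff_sum coeff_monom using assms by (intro sum.cong) auto
  then show ?thesis using assms by simp
qed

lemma degree_power_symbol: "degree (power_symbol L n i) \<le> n"
  unfolding power_symbol_def by (intro degree_sum_le) (auto intro!: order_trans[OF degree_monom_le])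

text \<open>Coefficient form of the rule that \<open>(z - w)^(n+1)\<close> has the
  \<open>w\<close>-derivative \<open>- (n+1) (z - w)^n\<close>. It rests on the absorption identity
  for binomial coefficients.\<close>

lemma pderiv_power_symbol:
  "pderiv (power_symbol L (Suc n) i) = smult (- of_nat (Suc n)) (power_symbol L n i)"
proof (rule poly_eqI)
  fix d
  show "coeff (pderiv (power_symbol L (Suc n) i)) d =
      coeff (smult (- of_nat (Suc n)) (power_symbol L n i)) d"
  proof (cases "d \<le> n")
    case True
    define j where "j = n - d"
    have d: "d = n - j" and "j \<le> n" using True by (auto simp: j_def)
    have "Suc d = Suc n - j" using True by (auto simp: j_def)
    then have "coeff (pderiv (power_symbol L (Suc n) i)) d =
        of_nat (Suc d * (Suc n choose j)) * (- 1) ^ Suc d * coeff (L (monom 1 j)) i"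
      using coeff_power_symbol[of j "Suc n" L i] \<open>j \<le> n\<close>
      by (simp only: coeff_pderiv of_nat_mult mult.assoc)
    also have "Suc d * (Suc n choose j) = Suc n * (n choose j)"
      using \<open>Suc d = Suc n - j\<close> binomial_absorb_comp[of "Suc n" j] by simp
    finally show ?thesis
      using coeff_power_symbol[OF \<open>j \<le> n\<close>, of L i] by (simp add: d[symmetric] algebra_simps)
  next
    case False
    then show ?thesis
      using degree_power_symbol[of L "Suc n" i] degree_power_symbol[of L n i]
      by (simp add: coeff_pderiv coeff_eq_0)
  qed
qed

text \<open>The product \<open>c * g\<close> vanishes everywhere, and polynomials have no zero
  divisors. Identities in \<open>w\<close> can thus be checked away from the zeros of a leading
  coefficient.\<close>

lemma poly_eq_0_if_generic:
  fixes c g :: "complex poly"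
  assumes "c \<noteq> 0" "\<And>w. poly c w \<noteq> 0 \<Longrightarrow> poly g w = 0"
  shows "g = 0"
proof -
  have "poly (c * g) w = 0" for w using assms(2)[of w] by auto
  then have "c * g = 0" by (simp add: poly_eq_poly_eq_iff[symmetric] fun_eq_iff)
  then show ?thesis using assms(1) by simp
qed

text \<open>Generic powers \<open>(z - w)^n\<close> determine the operator: the symbols agree as
  polynomials in \<open>w\<close>, and their coefficients at \<open>w^(n - j)\<close> give the image
  of \<open>z^j\<close> up to a common nonzero factor.\<close>

lemma linear_operators_eq_if_generic:
  assumes "linear_operator_on (polys_upto n) L" "linear_operator_on (polys_upto n) M"
    and "c \<noteq> 0" "\<And>w. poly c w \<noteq> 0 \<Longrightarrow> L ([:- w, 1:] ^ n) = M ([:- w, 1:] ^ n)"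
    and "P \<in> polys_upto n"
  shows "L P = M P"
proof -
  have "power_symbol L n i - power_symbol M n i = 0" for i
    by (rule poly_eq_0_if_generic[OF assms(3)]) (simp add: poly_power_symbol assms)
  then have eq: "power_symbol L n i = power_symbol M n i" for i by simp
  have "L (monom 1 j) = M (monom 1 j)" if "j \<le> n" for j
  proof (rule poly_eqI)
    fix i
    show "coeff (L (monom 1 j)) i = coeff (M (monom 1 j)) i"
      using coeff_power_symbol[OF that, of L i] coeff_power_symbol[OF that, of M i] that
      by (simp add: eq)
  qed
  then show ?thesis
    using linear_operator_on_expansion[OF assms(1,5)] linear_operator_on_expansion[OF assms(2,5)]
    by simp
qed

section \<open>Powers of linear polynomials and vanishing Wronskians\<close>

lemma power_if_diameter_zeros_0:
  assumes "degree A > 0" "diameter (zeros A) \<le> 0"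
  obtains b where "A = smult (lead_coeff A) ([:- b, 1:] ^ degree A)"
proof -
  have A0: "A \<noteq> 0" using assms(1) by auto
  obtain b where b: "poly A b = 0"
    using fundamental_theorem_of_algebra[of A] assms(1) by (auto simp: constant_degree)
  have "x = b" if "poly A x = 0" for x
    using norm_diff_le_diameter_zeros[OF A0 that b] assms(2)
    by (metis eq_iff_diff_eq_0 norm_le_zero_iff order_trans)
  then have Z: "{x. poly A x = 0} = {b}" using b by blast
  have A: "A = smult (lead_coeff A) ([:- b, 1:] ^ order b A)"
    using complex_poly_decompose[of A] unfolding Z by simp
  have "degree A = degree (smult (lead_coeff A) ([:- b, 1:] ^ order b A))"
    using A by (rule arg_cong)
  then have deg: "degree A = order b A" using A0 by (simp add: degree_linear_power)
  show ?thesis by (rule that) (rule A[folded deg])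
qed

text \<open>The top three coefficients of \<open>a (z - b)^m\<close> are \<open>a\<close>,
  \<open>- m a b\<close> and \<open>m (m - 1) a b^2 / 2\<close>; eliminating \<open>a\<close> and
  \<open>b\<close> gives the last claim.\<close>

lemma coeff_relation_power:
  fixes A :: "complex poly"
  assumes "A = smult a ([:- b, 1:] ^ m)" "m \<ge> 2"
  shows "coeff A m = a"
    and "coeff A (m - 1) = - (of_nat m * a * b)"
    and "2 * of_nat m * (coeff A m * coeff A (m - 2)) = of_nat (m - 1) * coeff A (m - 1) ^ 2"
proof -
  have c: "coeff A j = a * (of_nat (m choose j) * (- b) ^ (m - j))" for j
    by (cases "j \<le> m") (simp_all add: assms(1) coeff_linear_poly_power coeff_eq_0 degree_linear_power binomial_eq_0)
  obtain d where m: "m = Suc (Suc d)"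
    using assms(2) by (metis add_2_eq_Suc le_Suc_ex)
  show 1: "coeff A m = a"
    by (simp add: c)
  have e: "m choose (m - 1) = m" "m - (m - 1) = 1"
    by (simp_all add: m binomial_Suc_n)
  show 2: "coeff A (m - 1) = - (of_nat m * a * b)"
    by (simp only: c e) simp
  have "2 * (m choose (m - 2)) = m * (m - 1)"
  proof -
    have "even (m * (m - 1))" by (simp add: m)
    moreover have "m choose (m - 2) = m * (m - 1) div 2"
      using assms(2) by (simp add: binomial_symmetric[of 2 m, symmetric] choose_two)
    ultimately show ?thesis by simp
  qed
  then have "of_nat (2 * (m choose (m - 2))) = (of_nat (m * (m - 1)) :: complex)"
    by (rule arg_cong)
  then have ch: "2 * of_nat (m choose (m - 2)) = (of_nat m * of_nat (m - 1) :: complex)"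
    by (simp only: of_nat_mult of_nat_numeral)
  have 3: "coeff A (m - 2) = a * (of_nat (m choose (m - 2)) * b ^ 2)"
    using assms(2) by (simp add: c)
  have "2 * of_nat m * (coeff A m * coeff A (m - 2)) =
      of_nat m * a ^ 2 * (2 * of_nat (m choose (m - 2))) * b ^ 2"
    unfolding 1 3 by (simp add: power2_eq_square algebra_simps)
  also have "\<dots> = of_nat (m - 1) * coeff A (m - 1) ^ 2"
    unfolding ch 2 by (simp add: power2_eq_square algebra_simps)
  finally show "2 * of_nat m * (coeff A m * coeff A (m - 2)) = of_nat (m - 1) * coeff A (m - 1) ^ 2" .
qed

text \<open>Subtract the multiple of \<open>c\<close> for which the difference \<open>g\<close>
  vanishes at a point \<open>w\<close> with \<open>c(w) \<noteq> 0\<close>. The Wronskian of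
  \<open>c\<close> and \<open>g\<close> is still 0, so \<open>g\<close> vanishes at \<open>w\<close>
  to no higher order than its derivative, which is impossible unless \<open>g = 0\<close>.\<close>

lemma proportional_if_Wronskian_0:
  fixes c p :: "complex poly"
  assumes "c \<noteq> 0" "pderiv c * p = c * pderiv p"
  obtains a where "p = smult a c"
proof -
  have "\<exists>w. poly c w \<noteq> 0" using assms(1) poly_all_0_iff_0 by blast
  then obtain w where w: "poly c w \<noteq> 0" by blast
  define a where "a = poly p w / poly c w"
  define g where "g = p - smult a c"
  have g0: "poly g w = 0" using w by (simp add: g_def a_def)
  have W: "pderiv c * g = c * pderiv g"
    using assms(2) by (simp add: g_def pderiv_diff pderiv_smult right_diff_distrib mult.commute)
  have "g = 0"
  proof (rule ccontr)
    assume "g \<noteq> 0"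
    then have o: "order w g = Suc (order w (pderiv g))" using g0 by (rule order_pderiv)
    have "pderiv g \<noteq> 0"
    proof
      assume "pderiv g = 0"
      then obtain b where "g = [:b:]" by (auto simp: pderiv_eq_0_iff elim: degree_eq_zeroE)
      then show False using g0 \<open>g \<noteq> 0\<close> by simp
    qed
    then have "c * pderiv g \<noteq> 0" using assms(1) by simp
    then have "order w (pderiv c) + order w g = order w c + order w (pderiv g)"
      using W by (metis order_mult)
    then show False using o w by (simp add: order_0I)
  qed
  then show ?thesis using that by (simp add: g_def)
qed

text \<open>In the expansion of \<open>\<beta> (c' p - c p')^2\<close> replace
  \<open>\<beta> p^2\<close>, \<open>2 \<beta> p p'\<close> and \<open>\<beta> p'^2\<close> by means
  of the first relation, its derivative and the second relation. What remains is
  \<open>\<alpha> c c' (c' s - (c' s + c s') + c s') = 0\<close>.\<close>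

lemma Wronskian_0_if_relations:
  fixes c p s :: "complex poly"
  assumes "\<beta> \<noteq> 0"
    and "smult \<alpha> (c * s) = smult \<beta> (p ^ 2)"
    and "smult \<alpha> (pderiv c * pderiv s) = smult \<beta> (pderiv p ^ 2)"
  shows "pderiv c * p = c * pderiv p"
proof -
  \<comment> \<open>Scalars become constant polynomials, so that \<open>algebra\<close> can work in
    a single ring.\<close>
  define A B where "A = [:\<alpha>:]" and "B = [:\<beta>:]"
  have "pderiv (smult \<alpha> (c * s)) = pderiv (smult \<beta> (p ^ 2))"
    using assms(2) by simp
  then have "A * (pderiv c * s + c * pderiv s) = B * (2 * (p * pderiv p))"
    by (simp add: A_def B_def pderiv_smult pderiv_mult power2_eq_square smult_add_right algebra_simps)
  moreover have "A * (c * s) = B * p ^ 2" "A * (pderiv c * pderiv s) = B * pderiv p ^ 2"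
    using assms(2,3) by (simp_all add: A_def B_def)
  ultimately have "B * (pderiv c * p - c * pderiv p) ^ 2 = 0" by algebra
  then show ?thesis using assms(1) by (simp add: B_def)
qed

text \<open>This is what the coefficient relations use of the diameter condition, with the exponents
  \<open>n\<close> and \<open>n - 1\<close>. Constant images are left out because (A) says nothing
  about them.\<close>

definition maps_powers_to_powers :: "nat \<Rightarrow> (complex poly \<Rightarrow> complex poly) \<Rightarrow> bool" where
  "maps_powers_to_powers n L \<longleftrightarrow>
     (\<forall>w. degree (L ([:- w, 1:] ^ n)) > 0 \<longrightarrow>
        (\<exists>a b. L ([:- w, 1:] ^ n) = smult a ([:- b, 1:] ^ degree (L ([:- w, 1:] ^ n)))))"

lemma diam_nonincreasing_maps_powers_to_powers:
  assumes "diam_nonincreasing (polys_upto n) L" "1 \<le> j" "j \<le> n"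
  shows "maps_powers_to_powers j L"
  unfolding maps_powers_to_powers_def
proof (intro allI impI)
  fix w assume d: "degree (L ([:- w, 1:] ^ j)) > 0"
  have "degree ([:- w, 1:] ^ j) > 0"
    using assms(2) by (simp add: degree_linear_power)
  then have "diameter (zeros (L ([:- w, 1:] ^ j))) \<le> diameter (zeros ([:- w, 1:] ^ j))"
    using assms d linear_power_in_polys_upto unfolding diam_nonincreasing_def by blast
  then have "diameter (zeros (L ([:- w, 1:] ^ j))) \<le> 0"
    using assms(2) by (simp add: diameter_zeros_linear_power)
  then obtain b where "L ([:- w, 1:] ^ j) =
      smult (lead_coeff (L ([:- w, 1:] ^ j))) ([:- b, 1:] ^ degree (L ([:- w, 1:] ^ j)))"
    using power_if_diameter_zeros_0[OF d] by blast
  then show "\<exists>a b. L ([:- w, 1:] ^ j) = smult a ([:- b, 1:] ^ degree (L ([:- w, 1:] ^ j)))"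
    by blast
qed

lemma linear_on_subset: "linear_on V s t f \<Longrightarrow> U \<subseteq> V \<Longrightarrow> linear_on U s t f"
  unfolding linear_on_def by blast

lemma polys_upto_mono: "m \<le> n \<Longrightarrow> polys_upto m \<subseteq> polys_upto n"
  by (auto simp: polys_upto_def)

text \<open>Where \<open>q_m\<close> does not vanish, the image has degree exactly \<open>m\<close>
  and leading coefficient \<open>q_m(w)\<close>.\<close>

lemma generic_power:
  assumes "linear_operator_on (polys_upto n) L" "maps_powers_to_powers n L"
    and "\<And>i. i > m \<Longrightarrow> power_symbol L n i = 0" "m \<ge> 2"
    and "poly (power_symbol L n m) w \<noteq> 0"
  obtains b where "L ([:- w, 1:] ^ n) = smult (poly (power_symbol L n m) w) ([:- b, 1:] ^ m)"
proof -
  let ?A = "L ([:- w, 1:] ^ n)"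
  have c: "coeff ?A i = poly (power_symbol L n i) w" for i
    by (simp add: poly_power_symbol assms(1))
  have "degree ?A = m"
  proof (rule antisym)
    show "degree ?A \<le> m" by (rule degree_le) (simp add: c assms(3))
    show "m \<le> degree ?A" by (rule le_degree) (simp add: c assms(5))
  qed
  then obtain a b where "?A = smult a ([:- b, 1:] ^ m)"
    using assms(2,4) unfolding maps_powers_to_powers_def by force
  moreover from this have "a = poly (power_symbol L n m) w"
    using coeff_relation_power(1)[OF _ assms(4)] by (metis c)
  ultimately show ?thesis using that by simp
qed

lemma power_symbol_relation:
  assumes "linear_operator_on (polys_upto n) L" "maps_powers_to_powers n L"
    and "\<And>i. i > m \<Longrightarrow> power_symbol L n i = 0" "m \<ge> 2"
    and "power_symbol L n m \<noteq> 0"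
  shows "smult (2 * of_nat m) (power_symbol L n m * power_symbol L n (m - 2)) =
    smult (of_nat (m - 1)) (power_symbol L n (m - 1) ^ 2)"
proof -
  have "smult (2 * of_nat m) (power_symbol L n m * power_symbol L n (m - 2)) -
    smult (of_nat (m - 1)) (power_symbol L n (m - 1) ^ 2) = 0"
  proof (rule poly_eq_0_if_generic[OF assms(5)])
    fix w assume "poly (power_symbol L n m) w \<noteq> 0"
    then obtain b where "L ([:- w, 1:] ^ n) = smult (poly (power_symbol L n m) w) ([:- b, 1:] ^ m)"
      using generic_power[OF assms(1-4)] by blast
    from coeff_relation_power(3)[OF this assms(4)]
    show "poly (smult (2 * of_nat m) (power_symbol L n m * power_symbol L n (m - 2)) -
        smult (of_nat (m - 1)) (power_symbol L n (m - 1) ^ 2)) w = 0"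
      by (simp add: poly_power_symbol[OF assms(1), symmetric])
  qed
  then show ?thesis by simp
qed

text \<open>The derivatives of the symbols for \<open>n\<close> are multiples of those for
  \<open>n - 1\<close>. If \<open>q_m\<close> is not constant, \<open>m\<close> is also the top
  index for \<open>n - 1\<close>, and the quadratic relation holds for the symbols and for their
  derivatives.\<close>

lemma power_symbol_Wronskian:
  assumes "n \<ge> 1" "linear_operator_on (polys_upto n) L" "diam_nonincreasing (polys_upto n) L"
    and "\<And>i. i > m \<Longrightarrow> power_symbol L n i = 0" "m \<ge> 2"
    and "power_symbol L n m \<noteq> 0"
  defines "c \<equiv> power_symbol L n m" and "p \<equiv> power_symbol L n (m - 1)"
  shows "pderiv c = 0 \<or> pderiv c * p = c * pderiv p"
proof (cases "n = 1")
  case False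
  define k where "k = n - 1"
  have n: "n = Suc k" and k: "k \<ge> 1" using assms(1) False by (auto simp: k_def)
  show ?thesis
  proof (rule disjCI)
    assume "\<not> pderiv c * p = c * pderiv p"
    show "pderiv c = 0"
    proof (rule ccontr)
      assume "pderiv c \<noteq> 0"
      define u :: complex where "u = - of_nat (Suc k)"
      have u: "u \<noteq> 0" "pderiv (power_symbol L n i) = smult u (power_symbol L k i)" for i
        by (simp_all only: n pderiv_power_symbol u_def) (simp del: of_nat_Suc)
      have "power_symbol L k m \<noteq> 0"
        using u \<open>pderiv c \<noteq> 0\<close> by (auto simp: c_def)
      moreover have "power_symbol L k i = 0" if "i > m" for i
        using u(2)[of i] u(1) assms(4)[OF that] by simp
      moreover have "linear_operator_on (polys_upto k) L"
        using assms(2) by (rule linear_on_subset) (simp add: n polys_upto_mono)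
      moreover have "maps_powers_to_powers k L"
        using diam_nonincreasing_maps_powers_to_powers[OF assms(3) k] by (simp add: n)
      ultimately have "smult (2 * of_nat m) (power_symbol L k m * power_symbol L k (m - 2)) =
          smult (of_nat (m - 1)) (power_symbol L k (m - 1) ^ 2)"
        using assms(5) by (intro power_symbol_relation)
      \<comment> \<open>The relation is homogeneous of degree 2, so the factor \<open>u * u\<close>
        turns every symbol for \<open>k\<close> into a derivative of a symbol for
        \<open>n\<close>.\<close>
      then have "smult (u * u) (smult (2 * of_nat m) (power_symbol L k m * power_symbol L k (m - 2))) =
          smult (u * u) (smult (of_nat (m - 1)) (power_symbol L k (m - 1) ^ 2))"
        by (rule arg_cong)
      then have "smult (2 * of_nat m) (pderiv c * pderiv (power_symbol L n (m - 2))) =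
          smult (of_nat (m - 1)) (pderiv p ^ 2)"
        by (simp add: u(2) c_def p_def power2_eq_square mult_ac)
      moreover have "maps_powers_to_powers n L"
        by (rule diam_nonincreasing_maps_powers_to_powers[OF assms(3,1)]) simp
      then have "smult (2 * of_nat m) (c * power_symbol L n (m - 2)) = smult (of_nat (m - 1)) (p ^ 2)"
        unfolding c_def p_def by (intro power_symbol_relation assms)
      ultimately have "pderiv c * p = c * pderiv p"
        using assms(5) by (intro Wronskian_0_if_relations[of "of_nat (m - 1)"]) auto
      then show False using \<open>\<not> pderiv c * p = c * pderiv p\<close> by contradiction
    qed
  qed
next
  case True
  \<comment> \<open>The exponent \<open>n - 1 = 0\<close> gives no information. Instead all symbols
    have degree at most 1, and differentiating the relation twice yields the relation between the
    derivatives.\<close>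
  define s where "s = power_symbol L n (m - 2)"
  have d2: "pderiv (pderiv (power_symbol L n i)) = 0" for i
    using degree_power_symbol[of L n i] True by (simp add: pderiv_eq_0_iff degree_pderiv)
  have "maps_powers_to_powers n L"
    by (rule diam_nonincreasing_maps_powers_to_powers[OF assms(3,1)]) simp
  then have rel: "smult (2 * of_nat m) (c * s) = smult (of_nat (m - 1)) (p ^ 2)"
    unfolding c_def p_def s_def by (intro power_symbol_relation assms)
  then have "pderiv (pderiv (smult (2 * of_nat m) (c * s))) =
      pderiv (pderiv (smult (of_nat (m - 1)) (p ^ 2)))"
    by simp
  moreover have "pderiv (pderiv (c * s)) = 2 * (pderiv c * pderiv s)"
    by (simp add: pderiv_mult pderiv_add d2 c_def s_def algebra_simps)
  moreover have "pderiv (pderiv (p ^ 2)) = 2 * pderiv p ^ 2"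
    by (simp add: power2_eq_square pderiv_mult pderiv_add d2 p_def algebra_simps)
  ultimately have "2 * smult (2 * of_nat m) (pderiv c * pderiv s) =
      2 * smult (of_nat (m - 1)) (pderiv p ^ 2)"
    by (simp only: pderiv_smult mult_smult_right)
  then have "smult (2 * of_nat m) (pderiv c * pderiv s) = smult (of_nat (m - 1)) (pderiv p ^ 2)"
    by (simp only: mult_left_cancel[of "2 :: complex poly"] zero_neq_numeral[symmetric] simp_thms)
  then show ?thesis
    using rel assms(5) by (intro disjI2 Wronskian_0_if_relations[of "of_nat (m - 1)"]) auto
qed

text \<open>The order of the quantifiers matters: one constant serves all \<open>w\<close>.\<close>

lemma higher_pderiv_linear_power:
  assumes "k \<le> n"
  shows "\<exists>K. K \<noteq> 0 \<and> (\<forall>w :: complex. (pderiv ^^ k) ([:- w, 1:] ^ n) = smult K ([:- w, 1:] ^ (n - k)))"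
  using assms
proof (induction k)
  case 0
  show ?case by (intro exI[of _ 1]) simp
next
  case (Suc k)
  then obtain K where K: "K \<noteq> 0"
    "\<And>w :: complex. (pderiv ^^ k) ([:- w, 1:] ^ n) = smult K ([:- w, 1:] ^ (n - k))"
    by auto
  have nk: "n - k = Suc (n - Suc k)" using Suc.prems by simp
  show ?case
  proof (intro exI[of _ "K * of_nat (n - k)"] conjI allI)
    show "K * of_nat (n - k) \<noteq> 0" using K(1) Suc.prems by simp
    show "(pderiv ^^ Suc k) ([:- w, 1:] ^ n) = smult (K * of_nat (n - k)) ([:- w, 1:] ^ (n - Suc k))"
      for w :: complex
      by (simp add: K(2) nk pderiv_smult pderiv_power_Suc pderiv_pCons del: power_Suc of_nat_Suc)
  qed
qed

lemma ex_complex_root: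
  assumes "m > 0"
  obtains \<rho> :: complex where "\<rho> ^ m = x"
proof -
  have "degree (monom 1 m + [:- x:]) = m"
    using assms by (subst degree_add_eq_left) (auto simp: degree_monom_eq)
  then obtain \<rho> where "poly (monom 1 m + [:- x:]) \<rho> = 0"
    using fundamental_theorem_of_algebra[of "monom 1 m + [:- x:]"] assms by (auto simp: constant_degree)
  then show ?thesis using that by (simp add: poly_monom)
qed

lemma ex_nontrivial_root_of_unity:
  assumes "m \<ge> 2"
  obtains \<omega> :: complex where "\<omega> ^ m = 1" "\<omega> \<noteq> 1"
proof -
  have "card {z :: complex. z ^ m = 1} = m"
    using assms by (intro card_roots_unity_eq) simp
  then have "\<not> {z :: complex. z ^ m = 1} \<subseteq> {1}"
    using assms card_mono[of "{1 :: complex}" "{z. z ^ m = 1}"] by auto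
  then show ?thesis using that by blast
qed

section \<open>Classification for bounded degree\<close>

lemma affine_form_if_degree_le_1:
  assumes "linear_operator_on V L" "\<And>P. P \<in> V \<Longrightarrow> degree (L P) \<le> 1"
  shows "affine_form V L"
  unfolding affine_form_def
proof (intro exI conjI ballI)
  show "linear_functional_on V (\<lambda>P. coeff (L P) 1)" "linear_functional_on V (\<lambda>P. coeff (L P) 0)"
    using assms(1) by (simp_all add: linear_on_def)
  show "L P = [:coeff (L P) 0, coeff (L P) 1:]" if "P \<in> V" for P
    using assms(2)[OF that]
    by (intro poly_eqI) (auto simp: coeff_pCons coeff_eq_0 split: nat.splits)
qed

lemma power_form_if_power_multiple:
  assumes "linear_operator_on V L" "\<And>P. P \<in> V \<Longrightarrow> \<exists>a. L P = smult a ([:- b, 1:] ^ m)"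
    and "m \<ge> 2" "P \<in> V" "L P \<noteq> 0"
  shows "power_form V L"
  unfolding power_form_def
proof (intro exI conjI ballI)
  have eq: "L P = smult (coeff (L P) m) ([:- b, 1:] ^ m)" if "P \<in> V" for P
    using assms(2)[OF that] coeff_linear_power[of "- b" m] by auto
  show "linear_functional_on V (\<lambda>P. coeff (L P) m)"
    using assms(1) by (simp add: linear_on_def)
  show "L P = smult (coeff (L P) m) ([:- b, 1:] ^ m)" if "P \<in> V" for P
    using eq[OF that] .
  show "\<exists>P\<in>V. coeff (L P) m \<noteq> 0"
    using eq[OF assms(4)] assms(4,5) by (metis smult_0_left)
qed fact

text \<open>
  Scaling: for \<open>P = z\<^sup>n + t\<^sup>r\<^sup>m z\<^sup>n\<^sup>-\<^sup>r\<^sup>m\<close> the zeros have modulus at most \<open>t\<close>, while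
  those of \<open>L[P] = \<gamma> (z - b)\<^sup>m + t\<^sup>r\<^sup>m \<delta>\<close> are at distance of order \<open>t\<^sup>r\<close> from each other.
  Large \<open>t\<close> gives the claim.
\<close>

lemma scaling_exponent_le_1:
  assumes "linear_operator_on (polys_upto n) L" "diam_nonincreasing (polys_upto n) L"
    and "m \<ge> 2" "r \<ge> 1" "r * m \<le> n"
    and "L (monom 1 n) = smult \<gamma> ([:- b, 1:] ^ m)" "L (monom 1 (n - r * m)) = [:\<delta>:]"
    and "\<gamma> \<noteq> 0" "\<delta> \<noteq> 0"
  shows "r = 1"
proof (rule ccontr)
  assume "r \<noteq> 1"
  then have r2: "r \<ge> 2" using assms(4) by simp
  define j where "j = n - r * m"
  have rm: "r * m > 0" using assms(3,4) by simp
  have n: "n = j + r * m" using assms(5) by (simp add: j_def)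
  have jn: "j < n" using rm by (simp add: n)
  \<comment> \<open>With this choice \<open>b + t^r \<rho> \<eta>\<close> is a zero of the image of
    the test polynomial for every \<open>m\<close>-th root of unity \<open>\<eta>\<close>.\<close>
  obtain \<rho> where \<rho>: "\<rho> ^ m = - \<delta> / \<gamma>" using ex_complex_root[of m] assms(3) by auto
  have \<rho>0: "\<rho> \<noteq> 0"
  proof
    assume "\<rho> = 0"
    then show False using \<rho> assms(3,8,9) by (simp add: power_0_left)
  qed
  obtain \<omega> :: complex where \<omega>: "\<omega> ^ m = 1" "\<omega> \<noteq> 1"
    using ex_nontrivial_root_of_unity[OF assms(3)] by blast
  \<comment> \<open>The roots of unity 1 and \<open>\<omega>\<close> give zeros at distance
    \<open>t^r K\<close>. The choice of \<open>t\<close> below makes \<open>t K = K + 2 > 2\<close>,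
    against \<open>t^r K \<le> 2 t\<close> for \<open>r \<ge> 2\<close>.\<close>
  define K where "K = cmod \<rho> * cmod (1 - \<omega>)"
  have K: "K > 0" using \<rho>0 \<omega>(2) by (simp add: K_def)
  define t where "t = 1 + 2 / K"
  have t: "t > 1" using K by (simp add: t_def)
  define u :: complex where "u = of_real (t ^ (r * m))"
  define T where "T = monom 1 n + smult u (monom 1 j)"
  have degT: "degree T = n"
    unfolding T_def using jn
    by (subst degree_add_eq_left) (auto simp: degree_monom_eq intro!: le_less_trans[OF degree_smult_le])
  have mem: "monom 1 n \<in> polys_upto n" "smult u (monom 1 j) \<in> polys_upto n" "monom 1 j \<in> polys_upto n"
    using jn by (auto simp: polys_upto_def degree_monom_eq intro!: order_trans[OF degree_smult_le])
  have "L T = L (monom 1 n) + smult u (L (monom 1 j))"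
    using assms(1) mem unfolding linear_on_def T_def by metis
  then have LT: "L T = smult \<gamma> ([:- b, 1:] ^ m) + [:u * \<delta>:]"
    using assms(6,7) by (simp add: j_def)
  have degLT: "degree (L T) = m"
    unfolding LT using assms(3,8)
    by (subst degree_add_eq_left) (auto simp: degree_linear_power)
  have "poly (L T) (b + of_real (t ^ r) * \<rho> * \<eta>) = 0" if "\<eta> ^ m = 1" for \<eta>
  proof -
    have "poly (L T) (b + of_real (t ^ r) * \<rho> * \<eta>) = \<gamma> * (u * \<rho> ^ m * \<eta> ^ m) + u * \<delta>"
      by (simp add: LT u_def power_mult_distrib power_mult[symmetric] algebra_simps)
    then show ?thesis using assms(8) by (simp add: \<rho> that)
  qed
  from this[of 1] this[OF \<omega>(1)]
  have "cmod ((b + of_real (t ^ r) * \<rho> * 1) - (b + of_real (t ^ r) * \<rho> * \<omega>)) \<le> diameter (zeros (L T))"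
    using degLT assms(3) by (intro norm_diff_le_diameter_zeros) auto
  moreover have "(b + of_real (t ^ r) * \<rho> * 1) - (b + of_real (t ^ r) * \<rho> * \<omega>) =
      of_real (t ^ r) * (\<rho> * (1 - \<omega>))"
    by (simp add: algebra_simps)
  moreover have "cmod (of_real (t ^ r) * (\<rho> * (1 - \<omega>))) = t ^ r * K"
    using t by (simp only: norm_mult K_def norm_of_real) (simp add: power_abs)
  ultimately have "t ^ r * K \<le> diameter (zeros (L T))" by simp
  also have "\<dots> \<le> diameter (zeros T)"
    using assms(2,3) degT degLT jn unfolding diam_nonincreasing_def by (auto simp: polys_upto_def)
  also have "\<dots> \<le> 2 * t"
  proof (rule diameter_le)
    show "zeros T \<noteq> {} \<or> 0 \<le> 2 * t" using t by simp
    have bound: "cmod z \<le> t" if "z \<in> zeros T" for z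
    proof (cases "z = 0")
      case False
      have "z ^ j * (z ^ (r * m) + u) = 0"
        using that by (simp add: zeros_def T_def poly_monom n power_add algebra_simps)
      then have "z ^ (r * m) = - u" using False by (simp add: add_eq_0_iff)
      then have "cmod z ^ (r * m) = t ^ (r * m)"
        using t by (simp add: norm_power[symmetric] u_def) (simp add: norm_power)
      then show ?thesis using rm t by (simp add: power_eq_iff_eq_base)
    qed (use t in simp)
    show "norm (x - y) \<le> 2 * t" if "x \<in> zeros T" "y \<in> zeros T" for x y
      using bound[OF that(1)] bound[OF that(2)] norm_triangle_ineq4[of x y] by simp
  qed
  finally have "t ^ r * K \<le> 2 * t" .
  moreover have "t ^ 2 \<le> t ^ r" using t r2 by (intro power_increasing) auto
  then have "t ^ 2 * K \<le> t ^ r * K" using K by simp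
  ultimately have "t * (t * K) \<le> t * 2" by (simp add: power2_eq_square algebra_simps)
  then have "t * K \<le> 2" using t by simp
  moreover have "t * K = K + 2" using K by (simp add: t_def field_simps)
  ultimately show False using K by simp
qed

lemma pcompose_power:
  fixes p q :: "'a::comm_semiring_1 poly"
  shows "pcompose (p ^ n) q = pcompose p q ^ n"
  by (induction n) (simp_all add: pcompose_mult pcompose_1)

lemma derivative_form_if_linear_symbol:
  assumes "linear_operator_on (polys_upto n) L" "2 \<le> m" "m \<le> n" "\<gamma> \<noteq> 0" "\<alpha> \<noteq> 0"
    and "\<And>w. L ([:- w, 1:] ^ n) = smult \<gamma> ([:- (\<delta> + \<alpha> * w), 1:] ^ m)"
  shows "\<exists>k C a b. k + 2 \<le> n \<and> C \<noteq> 0 \<and> a \<noteq> 0 \<and>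
    (\<forall>P\<in>polys_upto n. L P = smult C (pcompose ((pderiv ^^ k) P) [:b, a:]))"
proof -
  define k where "k = n - m"
  have kn: "k \<le> n" "n - k = m" using assms(3) by (auto simp: k_def)
  obtain K where K: "K \<noteq> 0"
    "\<And>w :: complex. (pderiv ^^ k) ([:- w, 1:] ^ n) = smult K ([:- w, 1:] ^ m)"
    using higher_pderiv_linear_power[OF kn(1)] kn(2) by metis
  \<comment> \<open>The substitution of \<open>(z - \<delta>) / \<alpha>\<close> for
    \<open>z\<close> moves the zero \<open>w\<close> to \<open>\<delta> + \<alpha> w\<close>;
    \<open>C\<close> then adjusts the leading coefficient to \<open>\<gamma>\<close>.\<close>
  define a b where "a = 1 / \<alpha>" and "b = - \<delta> / \<alpha>"
  define C where "C = \<gamma> / (K * a ^ m)"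
  define M where "M P = smult C (pcompose ((pderiv ^^ k) P) [:b, a:])" for P
  have a: "a \<noteq> 0" using assms(5) by (simp add: a_def)
  have "L P = M P" if "P \<in> polys_upto n" for P
  proof (rule linear_operators_eq_if_generic[OF assms(1) _ _ _ that])
    show "linear_operator_on (polys_upto n) M"
      by (simp add: linear_on_def M_def higher_pderiv_add higher_pderiv_smult pcompose_add
          pcompose_smult smult_add_right mult.commute)
    show "(1 :: complex poly) \<noteq> 0" by simp
    fix w :: complex
    have "pcompose [:- w, 1:] [:b, a:] = smult a [:- (\<delta> + \<alpha> * w), 1:]"
      using assms(5) by (simp add: pcompose_pCons a_def b_def field_simps)
    then have "M ([:- w, 1:] ^ n) = smult (C * K) (smult a [:- (\<delta> + \<alpha> * w), 1:] ^ m)"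
      by (simp only: M_def K(2) pcompose_smult pcompose_power smult_smult)
    also have "\<dots> = smult (C * K * a ^ m) ([:- (\<delta> + \<alpha> * w), 1:] ^ m)"
      by (simp only: smult_power smult_smult)
    also have "C * K * a ^ m = \<gamma>" using K(1) a by (simp add: C_def)
    finally show "L ([:- w, 1:] ^ n) = M ([:- w, 1:] ^ n)" using assms(6) by simp
  qed
  moreover have "k + 2 \<le> n" using assms(2,3) by (simp add: k_def)
  moreover have "C \<noteq> 0" using K(1) a assms(4) by (simp add: C_def)
  ultimately show ?thesis using a unfolding M_def by blast
qed

text \<open>The largest index of a nonzero symbol decides between form 1 and the other two, and the
  dependence of the zero of \<open>L[(z - w)^n]\<close> on \<open>w\<close> decides between those.
  The size of \<open>a\<close> is bounded later, where bounded and unbounded degree differ.\<close>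

lemma diam_nonincreasing_cases:
  assumes n: "n \<ge> 1" and lin: "linear_operator_on (polys_upto n) L"
    and dn: "diam_nonincreasing (polys_upto n) L"
  shows "affine_form (polys_upto n) L \<or> power_form (polys_upto n) L \<or>
    (\<exists>k C a b. k + 2 \<le> n \<and> C \<noteq> 0 \<and> a \<noteq> 0 \<and>
      (\<forall>P\<in>polys_upto n. L P = smult C (pcompose ((pderiv ^^ k) P) [:b, a:])))"
proof -
  define q where "q = power_symbol L n"
  have q: "poly (q i) w = coeff (L ([:- w, 1:] ^ n)) i" for i w
    by (simp add: q_def poly_power_symbol lin)
  have powers: "maps_powers_to_powers n L"
    by (rule diam_nonincreasing_maps_powers_to_powers[OF dn n]) simp
  define I where "I = {i. q i \<noteq> 0}"
  \<comment> \<open>The images of finitely many monomials have bounded degree, so a largest index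
    exists.\<close>
  have "I \<subseteq> {..Max ((\<lambda>j. degree (L (monom 1 j))) ` {..n})}"
  proof (rule subsetI, rule ccontr)
    fix i assume i: "i \<in> I" "i \<notin> {..Max ((\<lambda>j. degree (L (monom 1 j))) ` {..n})}"
    have "coeff (L (monom 1 j)) i = 0" if "j \<le> n" for j
    proof (rule coeff_eq_0)
      have "degree (L (monom 1 j)) \<le> Max ((\<lambda>j. degree (L (monom 1 j))) ` {..n})"
        using that by (intro Max_ge) auto
      then show "degree (L (monom 1 j)) < i" using i(2) by simp
    qed
    then have "q i = 0" by (simp add: q_def power_symbol_def)
    then show False using i(1) by (simp add: I_def)
  qed
  then have finI: "finite I" using finite_subset by blast
  show ?thesis
  proof (cases "\<exists>i\<in>I. i \<ge> 2")
    case False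
    define M where "M P = [:coeff (L P) 0, coeff (L P) 1:]" for P
    have "L P = M P" if "P \<in> polys_upto n" for P
    proof (rule linear_operators_eq_if_generic[OF lin _ _ _ that])
      show "linear_operator_on (polys_upto n) M"
        using lin by (simp add: linear_on_def M_def)
      show "(1 :: complex poly) \<noteq> 0" by simp
      fix w
      have "coeff (L ([:- w, 1:] ^ n)) i = 0" if "i \<ge> 2" for i
      proof -
        have "q i = 0" using False that by (auto simp: I_def)
        then show ?thesis using q[of i w] by simp
      qed
      then show "L ([:- w, 1:] ^ n) = M ([:- w, 1:] ^ n)"
        by (intro poly_eqI) (auto simp: M_def coeff_pCons split: nat.splits)
    qed
    then have "degree (L P) \<le> 1" if "P \<in> polys_upto n" for P
      using degree_pCons_le[of "coeff (L P) 0" "[:coeff (L P) 1:]"] that unfolding M_def by fastforce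
    then show ?thesis using affine_form_if_degree_le_1[OF lin] by blast
  next
    case True
    define m where "m = Max I"
    have "m \<in> I" using True finI unfolding m_def by (intro Max_in) auto
    then have qm: "q m \<noteq> 0" by (simp add: I_def)
    obtain i0 where "i0 \<in> I" "i0 \<ge> 2" using True by blast
    then have m2: "m \<ge> 2" using Max_ge[OF finI, of i0] by (simp add: m_def)
    have above: "q i = 0" if "i > m" for i
    proof (rule ccontr)
      assume "q i \<noteq> 0"
      then have "i \<le> m" unfolding m_def by (intro Max_ge finI) (simp add: I_def)
      then show False using that by simp
    qed
    define c p where "c = q m" and "p = q (m - 1)"
    have m0: "of_nat m \<noteq> (0 :: complex)" using m2 by simp
    \<comment> \<open>The two leading coefficients determine the zero of the \<open>m\<close>-th
      power.\<close>
    have gen: "L ([:- w, 1:] ^ n) =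
        smult (poly c w) ([:- (- poly p w / (of_nat m * poly c w)), 1:] ^ m)"
      if nz: "poly c w \<noteq> 0" for w
    proof -
      have "poly (power_symbol L n m) w \<noteq> 0" using nz by (simp add: c_def q_def)
      then obtain b where b: "L ([:- w, 1:] ^ n) = smult (poly c w) ([:- b, 1:] ^ m)"
        using generic_power[OF lin powers _ m2] above unfolding c_def q_def by metis
      then have "poly p w = - (of_nat m * poly c w * b)"
        using coeff_relation_power(2)[OF b m2] by (simp add: p_def q)
      then have "- poly p w / (of_nat m * poly c w) = b" using nz m0 by simp
      then show ?thesis using b by (simp only:)
    qed
    have W: "pderiv c = 0 \<or> pderiv c * p = c * pderiv p"
      unfolding c_def p_def q_def
      by (rule power_symbol_Wronskian[OF n lin dn _ m2 qm[unfolded q_def]])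
        (use above in \<open>simp add: q_def\<close>)
    show ?thesis
    proof (cases "\<exists>a. p = smult a c")
      case True
      then obtain a where a: "p = smult a c" by blast
      \<comment> \<open>Proportionality of \<open>p\<close> and \<open>c\<close> makes the zero
        independent of \<open>w\<close>.\<close>
      define b where "b = - a / of_nat m"
      define M where "M P = smult (coeff (L P) m) ([:- b, 1:] ^ m)" for P
      have gen': "L ([:- w, 1:] ^ n) = smult (poly c w) ([:- b, 1:] ^ m)" if "poly c w \<noteq> 0" for w
      proof -
        have "- poly p w / (of_nat m * poly c w) = b" using that by (simp add: a b_def)
        then show ?thesis using gen[OF that] by (simp only:)
      qed
      have "L P = M P" if "P \<in> polys_upto n" for P
      proof (rule linear_operators_eq_if_generic[OF lin _ _ _ that])
        show "linear_operator_on (polys_upto n) M"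
          using lin by (simp add: linear_on_def M_def smult_add_left)
        show "c \<noteq> 0" using qm by (simp add: c_def)
        fix w assume "poly c w \<noteq> 0"
        from gen'[OF this] show "L ([:- w, 1:] ^ n) = M ([:- w, 1:] ^ n)"
          by (simp add: M_def coeff_linear_power)
      qed
      moreover obtain w where w: "poly c w \<noteq> 0"
        using qm poly_all_0_iff_0[of c] by (auto simp: c_def)
      have "L ([:- w, 1:] ^ n) \<noteq> 0" using gen'[OF w] w by simp
      ultimately have "power_form (polys_upto n) L"
        using m2 linear_power_in_polys_upto[OF order_refl]
        by (intro power_form_if_power_multiple[OF lin, of b m]) (auto simp: M_def)
      then show ?thesis by blast
    next
      case False
      then have "pderiv c = 0"
        using W proportional_if_Wronskian_0[of c p] qm by (auto simp: c_def)
      then obtain \<gamma> where c\<gamma>: "c = [:\<gamma>:]" by (auto simp: pderiv_eq_0_iff elim: degree_eq_zeroE)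
      have \<gamma>: "\<gamma> \<noteq> 0" using qm c\<gamma> by (auto simp: c_def)
      \<comment> \<open>The zero as a function of \<open>w\<close>; it is a polynomial because
        \<open>c\<close> is the constant \<open>\<gamma>\<close>.\<close>
      define \<beta> where "\<beta> = smult (- 1 / (of_nat m * \<gamma>)) p"
      have L\<beta>: "L ([:- w, 1:] ^ n) = smult \<gamma> ([:- poly \<beta> w, 1:] ^ m)" for w
        using gen[of w] \<gamma> by (simp add: c\<gamma> \<beta>_def)
      define r where "r = degree \<beta>"
      have r: "r \<ge> 1"
      proof (rule ccontr)
        assume "\<not> r \<ge> 1"
        then have "degree p = 0" using \<gamma> m0 by (simp add: r_def \<beta>_def)
        then obtain x where "p = [:x:]" by (auto elim: degree_eq_zeroE)
        then have "p = smult (x / \<gamma>) c" using \<gamma> by (simp add: c\<gamma>)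
        then show False using False by blast
      qed
      have qi: "q i = smult (\<gamma> * of_nat (m choose i)) ((- \<beta>) ^ (m - i))" if "i \<le> m" for i
        using that by (intro poly_ext) (simp add: q L\<beta> coeff_linear_poly_power)
      have degqi: "degree (q i) = r * (m - i)" if "i \<le> m" for i
      proof -
        have "\<beta> \<noteq> 0" using r by (auto simp: r_def)
        then show ?thesis using that \<gamma> by (simp add: qi degree_power_eq r_def mult.commute)
      qed
      have rm: "r * m \<le> n"
        using degqi[of 0] degree_power_symbol[of L n 0] by (simp add: q_def)
      \<comment> \<open>Since \<open>q_i\<close> has degree \<open>r (m - i)\<close> for
        \<open>i \<le> m\<close>, only \<open>q_0\<close> reaches degree \<open>r m\<close>. Hence
        \<open>z^j\<close> has a nonzero constant as its image, as the scaling argument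
        requires.\<close>
      define j where "j = n - r * m"
      have j: "j \<le> n" "n - j = r * m" using rm by (auto simp: j_def)
      have coeff_j: "coeff (q i) (r * m) =
          of_nat (n choose j) * (- 1) ^ (r * m) * coeff (L (monom 1 j)) i" for i
        using coeff_power_symbol[OF j(1), of L i] by (simp add: q_def j(2))
      have "coeff (L (monom 1 j)) i = 0" if "i > 0" for i
      proof -
        have "coeff (q i) (r * m) = 0"
        proof (cases "i \<le> m")
          case True
          then show ?thesis using that r by (intro coeff_eq_0) (simp add: degqi)
        next
          case False
          then show ?thesis by (simp add: above)
        qed
        then show ?thesis using coeff_j[of i] j(1) by simp
      qed
      then have Lj: "L (monom 1 j) = [:coeff (L (monom 1 j)) 0:]"
        by (intro poly_eqI) (auto simp: coeff_pCons split: nat.splits)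
      have "q 0 \<noteq> 0" using qi[of 0] \<gamma> r by (auto simp: r_def)
      then have "coeff (q 0) (r * m) \<noteq> 0" using degqi[of 0] leading_coeff_neq_0[of "q 0"] by simp
      then have \<delta>0: "coeff (L (monom 1 j)) 0 \<noteq> 0" using coeff_j[of 0] by auto
      have "[:- 0, 1:] ^ n = monom (1 :: complex) n" by (simp add: monom_altdef)
      then have Ln: "L (monom 1 n) = smult \<gamma> ([:- poly \<beta> 0, 1:] ^ m)" using L\<beta>[of 0] by simp
      have "r = 1"
        using scaling_exponent_le_1[OF lin dn m2 r rm Ln Lj[unfolded j_def] \<gamma> \<delta>0[unfolded j_def]] .
      define \<delta> \<alpha> where "\<delta> = coeff \<beta> 0" and "\<alpha> = coeff \<beta> 1"
      have "\<beta> = [:\<delta>, \<alpha>:]"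
        using \<open>r = 1\<close> by (intro poly_eqI)
          (auto simp: r_def \<delta>_def \<alpha>_def coeff_pCons coeff_eq_0 split: nat.splits)
      moreover have "\<alpha> \<noteq> 0"
        using \<open>r = 1\<close> leading_coeff_0_iff[of \<beta>] by (force simp: r_def \<alpha>_def)
      ultimately show ?thesis
        using rm \<open>r = 1\<close> L\<beta>
        by (intro disjI2 derivative_form_if_linear_symbol[OF lin m2 _ \<gamma>, of \<alpha> \<delta>])
          (simp_all add: mult.commute)
    qed
  qed
qed

section \<open>The equivalences\<close>

lemma diam_nonincreasing_if_nonzero: "diam_nonincreasing_nonzero V L \<Longrightarrow> diam_nonincreasing V L"
  by (auto simp: diam_nonincreasing_def diam_nonincreasing_nonzero_def)

lemma affine_form_diam_nonincreasing_nonzero: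
  assumes "linear_operator_on V L" "0 \<in> V" "affine_form V L"
  shows "diam_nonincreasing_nonzero V L"
  unfolding diam_nonincreasing_nonzero_def
proof (intro ballI impI)
  fix P assume P: "P \<in> V" "L P \<noteq> 0"
  then have "P \<noteq> 0" using linear_operator_on_0[OF assms(1,2)] by auto
  moreover have "degree (L P) \<le> 1"
    using assms(3) P(1) by (auto simp: affine_form_def)
  ultimately show "diameter (zeros (L P)) \<le> diameter (zeros P)"
    using P(2) by (simp add: diameter_zeros_degree_1 diameter_zeros_nonneg)
qed

lemma power_form_diam_nonincreasing_nonzero:
  assumes "linear_operator_on V L" "0 \<in> V" "power_form V L"
  shows "diam_nonincreasing_nonzero V L"
  unfolding diam_nonincreasing_nonzero_def
proof (intro ballI impI)
  fix P assume P: "P \<in> V" "L P \<noteq> 0"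
  then have P0: "P \<noteq> 0" using linear_operator_on_0[OF assms(1,2)] by auto
  obtain a m b where LP: "m \<ge> 2" "L P = smult a ([:- b, 1:] ^ m)"
    using assms(3) P(1) by (auto simp: power_form_def)
  then have "a \<noteq> 0" using P(2) by auto
  then have "diameter (zeros (L P)) = 0"
    using LP by (simp add: zeros_smult diameter_zeros_linear_power)
  then show "diameter (zeros (L P)) \<le> diameter (zeros P)"
    using diameter_zeros_nonneg[OF P0] by simp
qed

text \<open>The substitution divides the diameter for the \<open>k\<close>-th derivative by
  \<open>cmod a\<close>, which is at least \<open>d\<close>. The parameter \<open>d\<close> covers
  both \<open>diam_const n k\<close> and 1.\<close>

lemma derivative_form_diam_nonincreasing_nonzero:
  assumes "linear_operator_on V L" "0 \<in> V" "derivative_form V k d L"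
    and "\<And>P. P \<in> V \<Longrightarrow> k < degree P \<Longrightarrow>
      diameter (zeros ((pderiv ^^ k) P)) \<le> d * diameter (zeros P)"
  shows "diam_nonincreasing_nonzero V L"
  unfolding diam_nonincreasing_nonzero_def
proof (intro ballI impI)
  fix P assume P: "P \<in> V" "L P \<noteq> 0"
  then have P0: "P \<noteq> 0" using linear_operator_on_0[OF assms(1,2)] by auto
  obtain c l where cl: "c \<noteq> 0" "degree l \<le> 1" "\<And>z. d \<le> cmod (poly (pderiv l) z)"
    "L P = smult c ((pderiv ^^ k) (pcompose P l))"
    using assms(3) P(1) by (auto simp: derivative_form_def polys_upto_def)
  define a b where "a = coeff l 1" and "b = coeff l 0"
  have l: "l = [:b, a:]"
    using cl(2) by (intro poly_eqI) (auto simp: a_def b_def coeff_pCons coeff_eq_0 split: nat.splits)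
  have d: "d \<le> cmod a" using cl(3)[of 0] by (simp add: l pderiv_pCons)
  let ?Q = "(pderiv ^^ k) P"
  have LP: "L P = smult (c * a ^ k) (pcompose ?Q [:b, a:])"
    using cl(4) by (simp add: l higher_pderiv_pcompose_linear)
  show "diameter (zeros (L P)) \<le> diameter (zeros P)"
  \<comment> \<open>Here \<open>L P\<close> is a nonzero constant, and the convention for the empty
    set applies.\<close>
  proof (cases "degree P \<le> k \<or> a = 0")
    case True
    then have "degree (L P) = 0"
      by (auto simp: LP degree_pcompose degree_higher_pderiv)
    then show ?thesis
      using P(2) diameter_zeros_nonneg[OF P0] by (simp add: zeros_empty_if_degree_0)
  next
    case False
    then have "degree ?Q > 0" by (simp add: degree_higher_pderiv)
    then have "?Q \<noteq> 0" by auto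
    then have "diameter (zeros ?Q) = cmod a * diameter (zeros (L P))"
      using False cl(1) by (simp add: LP zeros_smult diameter_zeros_pcompose)
    then have "cmod a * diameter (zeros (L P)) \<le> d * diameter (zeros P)"
      using assms(4)[OF P(1)] False by simp
    also have "\<dots> \<le> cmod a * diameter (zeros P)"
      using d diameter_zeros_nonneg[OF P0] by (rule mult_right_mono)
    finally show ?thesis using False by simp
  qed
qed

lemma derivative_form_if_pcompose_linear:
  assumes "C \<noteq> 0" "a \<noteq> 0" "d \<le> cmod a"
    and "\<And>P. P \<in> V \<Longrightarrow> L P = smult C (pcompose ((pderiv ^^ k) P) [:b, a:])"
  shows "derivative_form V k d L"
  unfolding derivative_form_def
proof (intro exI conjI ballI allI)
  \<comment> \<open>Division by \<open>a ^ k\<close> compensates for differentiating after the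
    substitution.\<close>
  show "C / a ^ k \<noteq> 0" using assms by simp
  show "[:b, a:] \<in> polys_upto 1" by (simp add: polys_upto_def)
  show "d \<le> cmod (poly (pderiv [:b, a:]) z)" for z
    using assms(3) by (simp add: pderiv_pCons)
  show "L P = smult (C / a ^ k) ((pderiv ^^ k) (pcompose P [:b, a:]))" if "P \<in> V" for P
    using assms(2) assms(4)[OF that] by (simp add: higher_pderiv_pcompose_linear)
qed

text \<open>This makes \<open>cmod a\<close> an admissible constant for \<open>k\<close>-th
  derivatives, so that the least such constant bounds it from below.\<close>

lemma diameter_zeros_higher_pderiv_le_if_diam_nonincreasing:
  assumes "diam_nonincreasing V L" "C \<noteq> 0" "a \<noteq> 0"
    and "P \<in> V" "L P = smult C (pcompose ((pderiv ^^ k) P) [:b, a:])" "k < degree P"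
  shows "diameter (zeros ((pderiv ^^ k) P)) \<le> cmod a * diameter (zeros P)"
proof -
  let ?Q = "(pderiv ^^ k) P"
  have dQ: "degree ?Q > 0" using assms(6) by (simp add: degree_higher_pderiv)
  then have "?Q \<noteq> 0" by auto
  have "degree (L P) > 0"
    using assms dQ by (simp add: degree_pcompose)
  then have "diameter (zeros (L P)) \<le> diameter (zeros P)"
    using assms(1,4,6) unfolding diam_nonincreasing_def by auto
  then show ?thesis
    using assms(2,3,5) \<open>?Q \<noteq> 0\<close> by (simp add: zeros_smult diameter_zeros_pcompose[of a ?Q b])
qed

lemma derivative_form_if_diam_nonincreasing:
  assumes "diam_nonincreasing (polys_upto n) L" "k + 2 \<le> n" "C \<noteq> 0" "a \<noteq> 0"
    and "\<And>P. P \<in> polys_upto n \<Longrightarrow> L P = smult C (pcompose ((pderiv ^^ k) P) [:b, a:])"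
  shows "derivative_form (polys_upto n) k (diam_const n k) L"
proof (rule derivative_form_if_pcompose_linear[OF assms(3,4) _ assms(5)])
  show "diam_const n k \<le> cmod a"
  proof (rule diam_const_le[OF assms(2)])
    fix P assume P: "P \<in> polys_upto n - polys_upto k"
    then show "diameter (zeros ((pderiv ^^ k) P)) \<le> cmod a * diameter (zeros P)"
      using assms(5)[of P]
      by (intro diameter_zeros_higher_pderiv_le_if_diam_nonincreasing[OF assms(1,3,4)])
        (auto simp: polys_upto_def)
  qed
qed

section \<open>Polynomials of unbounded degree\<close>

lemma poly_higher_pderiv_multiple_root:
  fixes P :: "complex poly"
  assumes "[:- x, 1:] ^ Suc k dvd P"
  shows "poly ((pderiv ^^ k) P) x = 0"
  using assms
proof (induction k arbitrary: P)
  case 0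
  then show ?case by (simp add: poly_eq_0_iff_dvd)
next
  case (Suc k)
  then obtain R where R: "P = [:- x, 1:] ^ Suc (Suc k) * R" unfolding dvd_def by blast
  have "[:- x, 1:] ^ Suc k dvd pderiv P"
    unfolding R pderiv_mult pderiv_power_Suc
    by (intro dvd_add dvd_mult2[OF le_imp_power_dvd] dvd_mult[OF dvd_mult2[OF dvd_smult[OF dvd_refl]]])
      simp
  then show ?case using Suc.IH[of "pderiv P"] by (simp add: funpow_swap1)
qed

text \<open>The zeros 1 and -1 of \<open>(z^2 - 1)^(k+1)\<close> have multiplicity
  \<open>k + 1\<close> and survive \<open>k\<close> derivatives, so the diameter does not
  shrink.\<close>

lemma higher_pderiv_diameter_ratio_ge_1:
  assumes "\<And>P. k < degree P \<Longrightarrow> diameter (zeros ((pderiv ^^ k) P)) \<le> d * diameter (zeros P)"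
  shows "1 \<le> d"
proof -
  define P :: "complex poly" where "P = [:- 1, 1:] ^ Suc k * [:- (- 1), 1:] ^ Suc k"
  have degP: "degree P = 2 * Suc k"
    unfolding P_def by (subst degree_mult_eq) (simp_all add: degree_linear_power del: power_Suc)
  have Z: "poly P x = 0 \<longleftrightarrow> x = 1 \<or> x = - 1" for x
    by (auto simp: P_def add_eq_0_iff simp del: power_Suc)
  have "degree ((pderiv ^^ k) P) > 0" using degP by (simp add: degree_higher_pderiv)
  then have "(pderiv ^^ k) P \<noteq> 0" by auto
  moreover have "poly ((pderiv ^^ k) P) 1 = 0" "poly ((pderiv ^^ k) P) (- 1) = 0"
    by (rule poly_higher_pderiv_multiple_root, simp add: P_def del: power_Suc)+
  ultimately have "cmod (1 - (- 1)) \<le> diameter (zeros ((pderiv ^^ k) P))"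
    by (rule norm_diff_le_diameter_zeros)
  also have "\<dots> \<le> d * diameter (zeros P)" using assms degP by simp
  finally have two: "2 \<le> d * diameter (zeros P)" by simp
  have "diameter (zeros P) \<le> 2"
    by (rule diameter_le) (auto simp: zeros_def Z)
  moreover have "P \<noteq> 0" using degP by auto
  then have "0 \<le> diameter (zeros P)" by (rule diameter_zeros_nonneg)
  moreover have "diameter (zeros P) \<noteq> 0" using two by auto
  ultimately have D: "0 < diameter (zeros P)" "diameter (zeros P) \<le> 2" by simp_all
  show ?thesis
  proof (rule ccontr)
    assume "\<not> 1 \<le> d"
    then have "d * diameter (zeros P) < 1 * diameter (zeros P)"
      using D(1) by (intro mult_strict_right_mono) auto
    then show False using two D(2) by simp
  qed
qed

text \<open>The degree of the image of \<open>z^n\<close> gives \<open>k\<close>, the image of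
  \<open>z^k\<close> gives \<open>C\<close>, and that of \<open>z^(k+1)\<close> gives
  \<open>a\<close> and \<open>b\<close>. This serves to glue descriptions for different
  \<open>n\<close>.\<close>

lemma pcompose_linear_parameters_unique:
  fixes C C' a a' b b' :: complex
  assumes "\<And>P. P \<in> polys_upto n \<Longrightarrow>
      smult C (pcompose ((pderiv ^^ k) P) [:b, a:]) = smult C' (pcompose ((pderiv ^^ k') P) [:b', a':])"
    and "k + 2 \<le> n" "C \<noteq> 0" "a \<noteq> 0" "C' \<noteq> 0" "a' \<noteq> 0"
  shows "k = k' \<and> C = C' \<and> a = a' \<and> b = b'"
proof -
  have "degree (smult C (pcompose ((pderiv ^^ k) (monom 1 n)) [:b, a:])) =
      degree (smult C' (pcompose ((pderiv ^^ k') (monom 1 n)) [:b', a':]))"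
    using assms(1)[of "monom 1 n"] by (simp add: polys_upto_def degree_monom_eq)
  \<comment> \<open>Since \<open>n - k\<close> is at least 2, truncated subtraction loses
    nothing.\<close>
  then have k: "k = k'"
    using assms(2-) by (simp add: degree_pcompose degree_higher_pderiv degree_monom_eq)
  \<comment> \<open>These are \<open>k!\<close> and \<open>(k+1)!\<close>, from differentiating
    \<open>z^k\<close> and \<open>z^(k+1)\<close>.\<close>
  define x y :: complex where "x = of_nat (pochhammer 1 k)" and "y = of_nat (pochhammer 2 k)"
  have xy: "x \<noteq> 0" "y \<noteq> 0"
    unfolding x_def y_def of_nat_eq_0_iff
    using pochhammer_pos[of "1 :: nat" k] pochhammer_pos[of "2 :: nat" k] by linarith+
  have "(pderiv ^^ k) (monom 1 k) = [:x:]" "(pderiv ^^ k) (monom 1 (Suc k)) = [:0, y:]"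
    by (auto intro!: poly_eqI simp: coeff_higher_pderiv x_def y_def pochhammer_of_nat[symmetric]
        coeff_pCons simp del: monom_Suc split: nat.splits)
  then have "smult C [:x:] = smult C' [:x:]"
      "smult C (pcompose [:0, y:] [:b, a:]) = smult C' (pcompose [:0, y:] [:b', a':])"
    using assms(1)[of "monom 1 k"] assms(1)[of "monom 1 (Suc k)"] assms(2)
    by (simp_all add: polys_upto_def degree_monom_eq k)
  then show ?thesis using xy k assms(3) by (simp add: pcompose_pCons)
qed

text \<open>The restrictions to bounded degree are classified and glued. An image of degree at least
  2 excludes form 1 for large \<open>n\<close>; the parameters of the other forms do not change with
  \<open>n\<close>.\<close>

lemma diam_nonincreasing_UNIV_cases:
  assumes lin: "linear_operator_on UNIV L" and dn: "diam_nonincreasing UNIV L"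
  shows "affine_form UNIV L \<or> power_form UNIV L \<or>
    (\<exists>k C a b. C \<noteq> 0 \<and> a \<noteq> 0 \<and> (\<forall>P. L P = smult C (pcompose ((pderiv ^^ k) P) [:b, a:])))"
proof (cases "\<forall>P. degree (L P) \<le> 1")
  case True
  then show ?thesis using affine_form_if_degree_le_1[OF lin] by blast
next
  case False
  then obtain P0 where "\<not> degree (L P0) \<le> 1" by blast
  then have P0: "degree (L P0) \<ge> 2" by simp
  define n0 where "n0 = Suc (degree P0)"
  define F where "F n k C a b \<longleftrightarrow> C \<noteq> 0 \<and> a \<noteq> 0 \<and>
    (\<forall>P\<in>polys_upto n. L P = smult C (pcompose ((pderiv ^^ k) P) [:b, a:]))" for n k C a b
  have cases: "power_form (polys_upto n) L \<or> (\<exists>k C a b. k + 2 \<le> n \<and> F n k C a b)" if "n \<ge> n0" for n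
  proof -
    have "linear_operator_on (polys_upto n) L" "diam_nonincreasing (polys_upto n) L"
      using lin dn by (auto simp: linear_on_def diam_nonincreasing_def)
    moreover have "n \<ge> 1" using that by (simp add: n0_def)
    ultimately have "affine_form (polys_upto n) L \<or> power_form (polys_upto n) L \<or>
        (\<exists>k C a b. k + 2 \<le> n \<and> F n k C a b)"
      using diam_nonincreasing_cases unfolding F_def by presburger
    then
    consider "affine_form (polys_upto n) L" | "power_form (polys_upto n) L"
      | "\<exists>k C a b. k + 2 \<le> n \<and> F n k C a b"
      by blast
    then show ?thesis
    proof cases
      case 1
      have "P0 \<in> polys_upto n" using that by (simp add: polys_upto_def n0_def)
      then obtain u v where "L P0 = [:u, v:]" using 1 by (auto simp: affine_form_def)
      then show ?thesis using P0 degree_pCons_le[of u "[:v:]"] by simp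
    qed blast+
  qed
  have P0mem: "P0 \<in> polys_upto n" if "n \<ge> n0" for n
    using that by (simp add: polys_upto_def n0_def)
  show ?thesis
  proof (cases "\<exists>n k C a b. n \<ge> n0 \<and> k + 2 \<le> n \<and> F n k C a b")
    case True
    then obtain n k C a b where n: "n \<ge> n0" "k + 2 \<le> n" and F: "F n k C a b" by blast
    have "L P = smult C (pcompose ((pderiv ^^ k) P) [:b, a:])" for P
    proof -
      define N where "N = max n (degree P)"
      have N: "N \<ge> n" "P \<in> polys_upto N" by (auto simp: N_def polys_upto_def)
      \<comment> \<open>The image of \<open>z^(k+1)\<close> has degree 1, whereas a multiple of an
        \<open>m\<close>-th power with \<open>m \<ge> 2\<close> is 0 or has degree
        \<open>m\<close>.\<close>
      have "\<not> power_form (polys_upto N) L"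
      proof
        assume "power_form (polys_upto N) L"
        moreover have mem: "monom 1 (Suc k) \<in> polys_upto n" "monom 1 (Suc k) \<in> polys_upto N"
          using n(2) N(1) by (auto simp: polys_upto_def degree_monom_eq)
        ultimately obtain x c m where m: "m \<ge> 2" and L: "L (monom 1 (Suc k)) = smult x ([:- c, 1:] ^ m)"
          unfolding power_form_def by blast
        have "degree (L (monom 1 (Suc k))) = 1"
          using F mem(1)
          by (auto simp: F_def degree_pcompose degree_higher_pderiv degree_monom_eq)
        then show False using L m by (simp add: degree_linear_power split: if_splits)
      qed
      then obtain k' C' a' b' where F': "F N k' C' a' b'"
        using cases[of N] n(1) N(1) by (meson order_trans)
      have "k = k' \<and> C = C' \<and> a = a' \<and> b = b'"
      proof (rule pcompose_linear_parameters_unique[OF _ n(2)])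
        fix R assume "R \<in> polys_upto n"
        moreover from this have "R \<in> polys_upto N" using polys_upto_mono[OF N(1)] by blast
        ultimately show "smult C (pcompose ((pderiv ^^ k) R) [:b, a:]) =
            smult C' (pcompose ((pderiv ^^ k') R) [:b', a':])"
          using F F' unfolding F_def by metis
      qed (use F F' in \<open>auto simp: F_def\<close>)
      then show ?thesis using F' N(2) unfolding F_def by blast
    qed
    then show ?thesis using F unfolding F_def by blast
  next
    case no_derivative: False
    then have pf: "power_form (polys_upto n) L" if "n \<ge> n0" for n
      using cases[OF that] that by blast
    obtain x c m where m: "m \<ge> 2" and L0: "L P0 = smult x ([:- c, 1:] ^ m)"
      using pf[OF order_refl] P0mem[OF order_refl] unfolding power_form_def by blast
    have x: "x \<noteq> 0" using L0 P0 by auto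
    have "\<exists>y. L P = smult y ([:- c, 1:] ^ m)" for P
    proof -
      define N where "N = max n0 (degree P)"
      have N: "N \<ge> n0" "P \<in> polys_upto N" by (auto simp: N_def polys_upto_def)
      obtain x' y c' m' where m': "m' \<ge> 2" and L': "L P0 = smult x' ([:- c', 1:] ^ m')"
        "L P = smult y ([:- c', 1:] ^ m')"
        using pf[OF N(1)] P0mem[OF N(1)] N(2) unfolding power_form_def by blast
      have x': "x' \<noteq> 0" using L'(1) P0 by auto
      \<comment> \<open>The nonzero image \<open>L P0\<close> fixes the exponent by its degree and
        the centre by its zero.\<close>
      have "degree (L P0) = m" "degree (L P0) = m'"
        using x x' by (simp add: L0 degree_linear_power, simp add: L'(1) degree_linear_power)
      moreover have "poly (L P0) c = 0" using m by (simp add: L0)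
      then have "c = c'" using x' by (simp add: L'(1))
      ultimately show ?thesis using L'(2) by auto
    qed
    moreover have "L P0 \<noteq> 0" using P0 by auto
    ultimately show ?thesis using power_form_if_power_multiple[OF lin _ m] by blast
  qed
qed

theorem theorem3:
  "(\<forall>n::nat. \<forall>L :: complex poly \<Rightarrow> complex poly.
      n \<ge> 1 \<and> linear_operator_on (polys_upto n) L \<longrightarrow>
      (let B = affine_form (polys_upto n) L \<or> power_form (polys_upto n) L \<or>
             (\<exists>k. k + 2 \<le> n \<and> derivative_form (polys_upto n) k (diam_const n k) L)
       in (diam_nonincreasing (polys_upto n) L \<longleftrightarrow> B) \<and>
          (diam_nonincreasing_nonzero (polys_upto n) L \<longleftrightarrow> B))) \<and>
   (\<forall>L :: complex poly \<Rightarrow> complex poly.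
      linear_operator_on UNIV L \<longrightarrow>
      (let B = affine_form UNIV L \<or> power_form UNIV L \<or>
             (\<exists>k. derivative_form UNIV k 1 L)
       in (diam_nonincreasing UNIV L \<longleftrightarrow> B) \<and>
          (diam_nonincreasing_nonzero UNIV L \<longleftrightarrow> B)))"
proof (intro conjI allI impI)
  fix n :: nat and L :: "complex poly \<Rightarrow> complex poly"
  assume "n \<ge> 1 \<and> linear_operator_on (polys_upto n) L"
  then have n: "n \<ge> 1" and lin: "linear_operator_on (polys_upto n) L" by auto
  let ?V = "polys_upto n"
  let ?B = "affine_form ?V L \<or> power_form ?V L \<or>
    (\<exists>k. k + 2 \<le> n \<and> derivative_form ?V k (diam_const n k) L)"
  have V0: "0 \<in> ?V" by (simp add: polys_upto_def)
  have "diam_nonincreasing_nonzero ?V L" if "k + 2 \<le> n" "derivative_form ?V k (diam_const n k) L" for k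
    using that(2) by (rule derivative_form_diam_nonincreasing_nonzero[OF lin V0])
      (simp add: diam_const_admissible[OF that(1)] polys_upto_def)
  \<comment> \<open>The implications form a cycle: the forms give the inequality whenever
    \<open>L P \<noteq> 0\<close>, this implies (A), and (A) gives back the forms.\<close>
  then have "?B \<Longrightarrow> diam_nonincreasing_nonzero ?V L"
    using affine_form_diam_nonincreasing_nonzero[OF lin V0]
      power_form_diam_nonincreasing_nonzero[OF lin V0] by blast
  moreover have "?B" if dn: "diam_nonincreasing ?V L"
    using diam_nonincreasing_cases[OF n lin dn] derivative_form_if_diam_nonincreasing[OF dn] by blast
  ultimately show "let B = ?B in (diam_nonincreasing ?V L \<longleftrightarrow> B) \<and> (diam_nonincreasing_nonzero ?V L \<longleftrightarrow> B)"
    using diam_nonincreasing_if_nonzero[of ?V L] unfolding Let_def by blast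
next
  fix L :: "complex poly \<Rightarrow> complex poly"
  assume lin: "linear_operator_on UNIV L"
  let ?B = "affine_form UNIV L \<or> power_form UNIV L \<or> (\<exists>k. derivative_form UNIV k 1 L)"
  have "diam_nonincreasing_nonzero UNIV L" if "derivative_form UNIV k 1 L" for k
    using that by (rule derivative_form_diam_nonincreasing_nonzero[OF lin UNIV_I])
      (simp_all add: diameter_zeros_higher_pderiv_le)
  then have "?B \<Longrightarrow> diam_nonincreasing_nonzero UNIV L"
    using affine_form_diam_nonincreasing_nonzero[OF lin UNIV_I]
      power_form_diam_nonincreasing_nonzero[OF lin UNIV_I] by blast
  moreover have "?B" if dn: "diam_nonincreasing UNIV L"
  proof -
    have "derivative_form UNIV k 1 L" if Ca: "C \<noteq> 0" "a \<noteq> 0"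
      and L: "\<And>P. L P = smult C (pcompose ((pderiv ^^ k) P) [:b, a:])" for k C a b
    proof (rule derivative_form_if_pcompose_linear[OF Ca _ L])
      \<comment> \<open>\<open>cmod a\<close> is admissible for \<open>k\<close>-th derivatives in
        every degree, and such a constant is at least 1.\<close>
      show "1 \<le> cmod a"
        by (rule higher_pderiv_diameter_ratio_ge_1)
          (rule diameter_zeros_higher_pderiv_le_if_diam_nonincreasing[OF dn Ca UNIV_I L])
    qed
    then show ?thesis using diam_nonincreasing_UNIV_cases[OF lin dn] by blast
  qed
  ultimately show "let B = ?B in (diam_nonincreasing UNIV L \<longleftrightarrow> B) \<and> (diam_nonincreasing_nonzero UNIV L \<longleftrightarrow> B)"
    using diam_nonincreasing_if_nonzero[of UNIV L] unfolding Let_def by blast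
qed

end
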